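(* The MCAS algorithm described in the context (providing the operations MCAS and read, implemented from atomic read, write and CAS) is linearizable and lock-free.
   Context: Setting: asynchronous shared memory with $n$ threads and atomic read, write and compare-and-swap (CAS) operations; $\mathrm{CAS}(a,e,v)$ atomically reads address $a$ and, if its content equals $e$, stores $v$ in $a$; it returns an indication of success or failure. Specification: $\mathrm{MCAS}$ receives an array of tuples (address, expected value, new value); if all addresses hold their respective expected values, it atomically writes the new values to the corresponding addresses and returns an indication of success (true); otherwise (at least one value differs from the expected one) it returns an indication of failure (false) and changes no value. $\mathrm{read}(a)$ returns the current value at address $a$. Linearizable: each (read or MCAS) operation appears to take effect instantaneously at some point in time in the interval during which the operation executes. Lock-free: whenever there are ongoing operations and at least one of the threads executing them keeps taking steps, eventually at least one operation completes. Data structures: an MCASDescriptor $d$ has a field $d.status\in\{\mathrm{ACTIVE},\mathrm{SUCCESSFUL},\mathrm{FAILED}\}$, initially ACTIVE, and an array $d.words$ of WordDescriptors, one per target word, with (distinct) addresses sorted in increasing order with respect to a fixed total order on addresses. Each WordDescriptor $w$ has fields $w.address$, $w.old$ (expected value), $w.new$ (new value) and $w.parent$ (pointing to $d$), which are not modified by the algorithm. A descriptor is initialized before its MCAS operation is invoked, each MCAS operation has its own descriptor, and descriptors are never reclaimed or reused. Each memory word that can be a target contains either a plain value or a pointer to a WordDescriptor, and the two can be distinguished; initially all such words hold plain values, and they are accessed only through the operations below. readInternal$(addr, self)$: (R1) $val := *addr$. (R2) If $val$ is a plain value, return $(val,val)$. (R3) Let $p := val.parent$; if $p\neq self$ and $p.status=\mathrm{ACTIVE}$,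 call $\mathrm{MCAS}(p)$ (helping) and go to R1. (R4) Otherwise return $(val, val.new)$ if $p.status=\mathrm{SUCCESSFUL}$ and $(val,val.old)$ otherwise. read$(addr)$: $(c,v):=$ readInternal$(addr,\mathrm{null})$; return $v$. MCAS$(d)$: $success:=true$. For each $w$ in $d.words$, in order: (M1) $(c,v):=$ readInternal$(w.address,d)$. (M2) If $c$ is a pointer to $w$, go on to the next word. (M3) If $v\ne w.old$, set $success:=false$ and exit the loop. (M4) If $d.status\neq\mathrm{ACTIVE}$, exit the loop. (M5) Perform $\mathrm{CAS}(w.address,c,\text{pointer to }w)$; if it fails, go back to M1 for the same $w$; otherwise go on to the next word. After the loop: (M6) perform $\mathrm{CAS}(d.status,\mathrm{ACTIVE},s)$ with $s=\mathrm{SUCCESSFUL}$ if $success$ is true and $s=\mathrm{FAILED}$ otherwise. Return true if $d.status=\mathrm{SUCCESSFUL}$ and false otherwise. *)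

theory Defs
  imports Complex_Main
begin

section \<open>Concurrent objects: histories, linearizability, lock-freedom\<close>

text \<open>Labels of the steps of a concurrent implementation: a thread invokes an operation, takes an
  internal step of the operation it is executing, or returns from that operation.\<close>

datatype ('t, 'o, 'r) label = Inv 't 'o | Tau 't | Res 't 'r

fun thread_of :: "('t, 'o, 'r) label \<Rightarrow> 't" where
  "thread_of (Inv t x) = t"
| "thread_of (Tau t) = t"
| "thread_of (Res t r) = t"

definition is_inv :: "('t, 'o, 'r) label \<Rightarrow> bool" where
  "is_inv l \<longleftrightarrow> (\<exists>t x. l = Inv t x)"

definition is_res :: "('t, 'o, 'r) label \<Rightarrow> bool" where
  "is_res l \<longleftrightarrow> (\<exists>t r. l = Res t r)"

inductive run :: "('c \<Rightarrow> 'l \<Rightarrow> 'c \<Rightarrow> bool) \<Rightarrow> 'c \<Rightarrow> 'l list \<Rightarrow> 'c \<Rightarrow> bool"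
  for step :: "'c \<Rightarrow> 'l \<Rightarrow> 'c \<Rightarrow> bool" and c0 :: 'c where
  run_Nil: "run step c0 [] c0"
| run_snoc: "run step c0 ls c \<Longrightarrow> step c l c' \<Longrightarrow> run step c0 (ls @ [l]) c'"

definition history :: "('t, 'o, 'r) label list \<Rightarrow> ('t, 'o, 'r) label list" where
  "history ls = filter (\<lambda>l. is_inv l \<or> is_res l) ls"

text \<open>An operation of a history \<open>h\<close> is identified with the index \<open>i\<close> of its invocation;
  it completes at \<open>j\<close> with result \<open>r\<close> if the next event of the same thread is \<open>h ! j = Res t r\<close>.\<close>

definition invokes :: "('t, 'o, 'r) label list \<Rightarrow> nat \<Rightarrow> 'o \<Rightarrow> bool" where
  "invokes h i x \<longleftrightarrow> i < length h \<and> (\<exists>t. h ! i = Inv t x)"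

definition completes :: "('t, 'o, 'r) label list \<Rightarrow> nat \<Rightarrow> nat \<Rightarrow> 'r \<Rightarrow> bool" where
  "completes h i j r \<longleftrightarrow> i < j \<and> j < length h \<and>
     (\<exists>t x. h ! i = Inv t x \<and> h ! j = Res t r \<and>
        (\<forall>k. i < k \<and> k < j \<longrightarrow> thread_of (h ! k) \<noteq> t))"

text \<open>A sequential object is given by a function mapping a state and an operation to the new state
  and the result.\<close>

fun legal :: "('s \<Rightarrow> 'o \<Rightarrow> 's \<times> 'r) \<Rightarrow> 's \<Rightarrow> ('o \<times> 'r) list \<Rightarrow> bool" where
  "legal spec s [] \<longleftrightarrow> True"
| "legal spec s ((x, r) # xs) \<longleftrightarrow> snd (spec s x) = r \<and> legal spec (fst (spec s x)) xs"

text \<open>The time of an event is its index in the history. The list \<open>L\<close> consists of triples (operation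
  identifier, operation, result): all completed operations of \<open>h\<close> and possibly some pending ones (with
  the result they are going to return), listed in the order of the points \<open>pt\<close> at which they take
  effect.\<close>

definition linearizable_history ::
  "('s \<Rightarrow> 'o \<Rightarrow> 's \<times> 'r) \<Rightarrow> 's \<Rightarrow> ('t, 'o, 'r) label list \<Rightarrow> bool" where
  "linearizable_history spec s0 h \<longleftrightarrow>
     (\<exists>(L :: (nat \<times> 'o \<times> 'r) list) (pt :: nat \<Rightarrow> real).
        distinct (map fst L) \<and>
        (\<forall>(i, x, r) \<in> set L. invokes h i x) \<and>
        (\<forall>i j r. completes h i j r \<longrightarrow> (\<exists>x. (i, x, r) \<in> set L)) \<and>
        (\<forall>(i, x, r) \<in> set L. real i < pt i \<and> (\<forall>j r'. completes h i j r' \<longrightarrow> pt i < real j)) \<and>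
        sorted_wrt (<) (map (pt \<circ> fst) L) \<and>
        legal spec s0 (map snd L))"

definition linearizable ::
  "('s \<Rightarrow> 'o \<Rightarrow> 's \<times> 'r) \<Rightarrow> 's \<Rightarrow> ('c \<Rightarrow> ('t, 'o, 'r) label \<Rightarrow> 'c \<Rightarrow> bool) \<Rightarrow> 'c \<Rightarrow> bool" where
  "linearizable spec s0 step c0 \<longleftrightarrow>
     (\<forall>ls c. run step c0 ls c \<longrightarrow> linearizable_history spec s0 (history ls))"

text \<open>In the infinite execution with labels \<open>l\<close>, thread \<open>t\<close> is executing an operation just before
  step \<open>i\<close>.\<close>

definition ongoing :: "(nat \<Rightarrow> ('t, 'o, 'r) label) \<Rightarrow> 't \<Rightarrow> nat \<Rightarrow> bool" where
  "ongoing l t i \<longleftrightarrow>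
     (\<exists>k < i. (\<exists>x. l k = Inv t x) \<and> (\<forall>m. k < m \<and> m < i \<longrightarrow> (\<nexists>r. l m = Res t r)))"

definition lock_free :: "('c \<Rightarrow> ('t, 'o, 'r) label \<Rightarrow> 'c \<Rightarrow> bool) \<Rightarrow> 'c \<Rightarrow> bool" where
  "lock_free step c0 \<longleftrightarrow>
     (\<forall>(c :: nat \<Rightarrow> 'c) l. c 0 = c0 \<and> (\<forall>i. step (c i) (l i) (c (Suc i))) \<longrightarrow>
        (\<forall>i t. ongoing l t i \<and> (\<forall>m. \<exists>k \<ge> m. thread_of (l k) = t) \<longrightarrow>
           (\<exists>k \<ge> i. is_res (l k))))"


section \<open>The sequential specification of multi-word compare-and-swap\<close>

datatype ('a, 'v) mop = Read_Op 'a | MCAS_Op "('a \<times> 'v \<times> 'v) list"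

datatype 'v result = Value 'v | Flag bool

fun mcas_spec :: "('a \<Rightarrow> 'v) \<Rightarrow> ('a, 'v) mop \<Rightarrow> ('a \<Rightarrow> 'v) \<times> 'v result" where
  "mcas_spec s (Read_Op a) = (s, Value (s a))"
| "mcas_spec s (MCAS_Op ts) =
     (if \<forall>(a, e, v) \<in> set ts. s a = e
      then (fold (\<lambda>(a, e, v) s. s(a := v)) ts s, Flag True)
      else (s, Flag False))"


section \<open>The algorithm\<close>

datatype status = ACTIVE | SUCCESSFUL | FAILED

text \<open>\<open>'d\<close> and \<open>'w\<close> are the types of pointers to MCASDescriptors and to WordDescriptors.\<close>

datatype ('v, 'w) content = Plain 'v | Ptr 'w

text \<open>The descriptor fields that the algorithm does not modify. As a descriptor is initialized before
  its operation is invoked and never reused, they are constant throughout an execution. The only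
  mutable field, \<open>status\<close>, is part of the configuration below.\<close>

record ('a, 'v, 'w, 'd) descriptors =
  address :: "'w \<Rightarrow> 'a"
  old :: "'w \<Rightarrow> 'v"
  new :: "'w \<Rightarrow> 'v"
  parent :: "'w \<Rightarrow> 'd"
  words :: "'d \<Rightarrow> 'w list"

definition wf_descriptors :: "('a :: linorder, 'v, 'w, 'd) descriptors \<Rightarrow> bool" where
  "wf_descriptors D \<longleftrightarrow>
     (\<forall>d. \<forall>w \<in> set (words D d). parent D w = d) \<and>
     (\<forall>d. sorted_wrt (<) (map (address D) (words D d)))"

definition tuples :: "('a, 'v, 'w, 'd) descriptors \<Rightarrow> 'd \<Rightarrow> ('a \<times> 'v \<times> 'v) list" where
  "tuples D d = map (\<lambda>w. (address D w, old D w, new D w)) (words D d)"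

text \<open>The call stack of a thread. The caller of readInternal is either read or MCAS at line M1
  (for descriptor, current word and remaining words as given). An MCAS call is either a whole
  operation or made at line R3 of readInternal with the given arguments.\<close>

datatype ('a, 'w, 'd) read_caller =
    From_Read
  | From_M1 'd 'w "'w list" "('a, 'w, 'd) mcas_caller"
and ('a, 'w, 'd) mcas_caller =
    From_Op
  | From_R3 'a "'d option" "('a, 'w, 'd) read_caller"

text \<open>The control state of a thread: the next line to be executed, with the local variables. The null
  value of \<open>self\<close> is \<open>None\<close>. \<open>Loop d ws k\<close> is the head of the loop of MCAS with the words \<open>ws\<close> still
  to be processed. The variable \<open>success\<close> is true throughout the loop, so it is recorded only from M6
  on. M7 is the final status test of MCAS.\<close>

datatype ('a, 'v, 'w, 'd) control =
    Idle
  | R1 'a "'d option" "('a, 'w, 'd) read_caller"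
  | R3 'a "'d option" 'w "('a, 'w, 'd) read_caller"
  | R4 'w "('a, 'w, 'd) read_caller"
  | Loop 'd "'w list" "('a, 'w, 'd) mcas_caller"
  | M2 'd 'w "'w list" "('v, 'w) content" 'v "('a, 'w, 'd) mcas_caller"
  | M3 'd 'w "'w list" "('v, 'w) content" 'v "('a, 'w, 'd) mcas_caller"
  | M4 'd 'w "'w list" "('v, 'w) content" "('a, 'w, 'd) mcas_caller"
  | M5 'd 'w "'w list" "('v, 'w) content" "('a, 'w, 'd) mcas_caller"
  | M6 'd bool "('a, 'w, 'd) mcas_caller"
  | M7 'd "('a, 'w, 'd) mcas_caller"
  | Done "'v result"

fun return_readInternal ::
  "('v, 'w) content \<Rightarrow> 'v \<Rightarrow> ('a, 'w, 'd) read_caller \<Rightarrow> ('a, 'v, 'w, 'd) control" where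
  "return_readInternal c v From_Read = Done (Value v)"
| "return_readInternal c v (From_M1 d w ws k) = M2 d w ws c v k"

fun return_MCAS :: "bool \<Rightarrow> ('a, 'w, 'd) mcas_caller \<Rightarrow> ('a, 'v, 'w, 'd) control" where
  "return_MCAS b From_Op = Done (Flag b)"
| "return_MCAS b (From_R3 a self k) = R1 a self k"

type_synonym ('a, 'v, 'w, 'd) shared = "('a \<Rightarrow> ('v, 'w) content) \<times> ('d \<Rightarrow> status)"

text \<open>One step of a thread executing an operation. Every step makes at most one access (read or CAS)
  to the mutable shared memory, consisting of the target words \<open>m\<close> and the status fields \<open>st\<close>.\<close>

fun exec :: "('a, 'v, 'w, 'd) descriptors \<Rightarrow> ('a, 'v, 'w, 'd) shared \<Rightarrow> ('a, 'v, 'w, 'd) control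
    \<Rightarrow> ('a, 'v, 'w, 'd) shared \<times> ('a, 'v, 'w, 'd) control" where
  "exec D (m, st) (R1 a self k) =
     ((m, st), case m a of Plain v \<Rightarrow> return_readInternal (Plain v) v k | Ptr w \<Rightarrow> R3 a self w k)"
| "exec D (m, st) (R3 a self w k) =
     ((m, st),
      let p = parent D w in
      if Some p \<noteq> self \<and> st p = ACTIVE then Loop p (words D p) (From_R3 a self k) else R4 w k)"
| "exec D (m, st) (R4 w k) =
     ((m, st),
      return_readInternal (Ptr w) (if st (parent D w) = SUCCESSFUL then new D w else old D w) k)"
| "exec D (m, st) (Loop d [] k) = ((m, st), M6 d True k)"
| "exec D (m, st) (Loop d (w # ws) k) = ((m, st), R1 (address D w) (Some d) (From_M1 d w ws k))"
| "exec D (m, st) (M2 d w ws c v k) = ((m, st), if c = Ptr w then Loop d ws k else M3 d w ws c v k)"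
| "exec D (m, st) (M3 d w ws c v k) =
     ((m, st), if v \<noteq> old D w then M6 d False k else M4 d w ws c k)"
| "exec D (m, st) (M4 d w ws c k) = ((m, st), if st d \<noteq> ACTIVE then M6 d True k else M5 d w ws c k)"
| "exec D (m, st) (M5 d w ws c k) =
     (if m (address D w) = c
      then ((m(address D w := Ptr w), st), Loop d ws k)
      else ((m, st), Loop d (w # ws) k))"
| "exec D (m, st) (M6 d success k) =
     ((m, if st d = ACTIVE then st(d := (if success then SUCCESSFUL else FAILED)) else st), M7 d k)"
| "exec D (m, st) (M7 d k) = ((m, st), return_MCAS (st d = SUCCESSFUL) k)"
| "exec D (m, st) Idle = ((m, st), Idle)"
| "exec D (m, st) (Done r) = ((m, st), Done r)"

text \<open>\<open>used\<close> is the set of the descriptors whose operation has been invoked; it is not accessible to the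
  algorithm and only ensures that each MCAS operation has its own descriptor.\<close>

record ('t, 'a, 'v, 'w, 'd) config =
  shared :: "('a, 'v, 'w, 'd) shared"
  control :: "'t \<Rightarrow> ('a, 'v, 'w, 'd) control"
  used :: "'d set"

definition initial :: "('a \<Rightarrow> 'v) \<Rightarrow> ('t, 'a, 'v, 'w, 'd) config" where
  "initial s0 = \<lparr>shared = (\<lambda>a. Plain (s0 a), \<lambda>d. ACTIVE), control = (\<lambda>t. Idle), used = {}\<rparr>"

inductive mcas_step :: "('a, 'v, 'w, 'd) descriptors \<Rightarrow> ('t, 'a, 'v, 'w, 'd) config
    \<Rightarrow> ('t, ('a, 'v) mop, 'v result) label \<Rightarrow> ('t, 'a, 'v, 'w, 'd) config \<Rightarrow> bool"
  for D :: "('a, 'v, 'w, 'd) descriptors" where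
  invoke_read:
    "control c t = Idle \<Longrightarrow>
     mcas_step D c (Inv t (Read_Op a)) (c\<lparr>control := (control c)(t := R1 a None From_Read)\<rparr>)"
| invoke_MCAS:
    "control c t = Idle \<Longrightarrow> d \<notin> used c \<Longrightarrow>
     mcas_step D c (Inv t (MCAS_Op (tuples D d)))
       (c\<lparr>control := (control c)(t := Loop d (words D d) From_Op), used := insert d (used c)\<rparr>)"
| internal:
    "control c t \<noteq> Idle \<Longrightarrow> (\<nexists>r. control c t = Done r) \<Longrightarrow>
     exec D (shared c) (control c t) = (sh, k) \<Longrightarrow>
     mcas_step D c (Tau t) (c\<lparr>shared := sh, control := (control c)(t := k)\<rparr>)"
| respond:
    "control c t = Done r \<Longrightarrow>
     mcas_step D c (Res t r) (c\<lparr>control := (control c)(t := Idle)\<rparr>)"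

text \<open>A thread executing an operation is never blocked, so the hypothesis of \<^const>\<open>lock_free\<close> that it
  keeps taking steps only concerns the scheduling.\<close>

lemma mcas_step_enabled:
  assumes "control c t \<noteq> Idle"
  shows "\<exists>l c'. mcas_step D c l c' \<and> thread_of l = t"
proof (cases "\<exists>r. control c t = Done r")
  case True
  then show ?thesis by (metis respond thread_of.simps(3))
next
  case False
  obtain sh k where "exec D (shared c) (control c t) = (sh, k)" by fastforce
  with assms False show ?thesis by (metis internal thread_of.simps(2))
qed

end

(* A successful MCAS takes effect when the CAS at M6 makes its descriptor SUCCESSFUL: at that moment all
   its words are installed, and the value represented by a word at an address is a function of the
   status of its descriptor. No other step changes the represented values, because a pointer is
   installed at an address at most once (no ABA), only over a settled content, and never after its
   descriptor has succeeded. A read, or an MCAS that fails, takes effect at some past moment of its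
   own interval, at which the value it relies on was the represented one; that moment exists but can
   only be chosen once the outcome is known, so the linearization is read off the whole execution.

   For lock-freedom, an execution without further responses eventually has no invocations, and then
   no modifications of the shared memory, since pointers are installed and statuses decided at most
   once. In a fixed memory every thread completes or modifies the memory after finitely many steps,
   because the addresses at which nested helping calls get blocked are strictly increasing. *)

theory Submission
  imports Defs
begin

section \<open>Invariants of an execution\<close>

fun content_value :: "('a, 'v, 'w, 'd) descriptors \<Rightarrow> ('d \<Rightarrow> status) \<Rightarrow> ('v, 'w) content \<Rightarrow> 'v" where
  "content_value D st (Plain v) = v"
| "content_value D st (Ptr w) = (if st (parent D w) = SUCCESSFUL then new D w else old D w)"

text \<open>readInternal has only two call sites. The null \<open>self\<close> of a plain read
  ensures that such a call reaches R4 only with a decided descriptor.\<close>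

definition frame :: "('a, 'v, 'w, 'd) descriptors \<Rightarrow> 'a \<Rightarrow> 'd option \<Rightarrow> ('a, 'w, 'd) read_caller \<Rightarrow> bool" where
  "frame D a self rc \<longleftrightarrow>
     (case rc of From_Read \<Rightarrow> self = None | From_M1 d w ws mc \<Rightarrow> self = Some d \<and> a = address D w)"

lemma frame_simps [simp]:
  "frame D a self From_Read \<longleftrightarrow> self = None"
  "frame D a self (From_M1 d w ws mc) \<longleftrightarrow> self = Some d \<and> a = address D w"
  by (simp_all add: frame_def)

text \<open>The cut at \<open>n\<close> lets the same invariants serve the finite runs of
  linearizability and, for every \<open>n\<close>, the infinite executions of lock-freedom.\<close>

locale execution =
  fixes D :: "('a :: linorder, 'v, 'w, 'd) descriptors"
    and s0 :: "'a \<Rightarrow> 'v"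
    and c :: "nat \<Rightarrow> ('t, 'a, 'v, 'w, 'd) config"
    and l :: "nat \<Rightarrow> ('t, ('a, 'v) mop, 'v result) label"
    and n :: nat
  assumes wf: "wf_descriptors D"
    and init: "c 0 = initial s0"
    and step: "k < n \<Longrightarrow> mcas_step D (c k) (l k) (c (Suc k))"
begin

section \<open>Represented states and the invariants\<close>

definition mem :: "nat \<Rightarrow> 'a \<Rightarrow> ('v, 'w) content" where
  "mem k = fst (shared (c k))"

definition stat :: "nat \<Rightarrow> 'd \<Rightarrow> status" where
  "stat k = snd (shared (c k))"

definition val :: "nat \<Rightarrow> ('v, 'w) content \<Rightarrow> 'v" where
  "val k = content_value D (stat k)"

definition abs_state :: "nat \<Rightarrow> 'a \<Rightarrow> 'v" where
  "abs_state k a = val k (mem k a)"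

text \<open>All contents up to now, not only the current one: threads hold stale contents, and the
  absence of ABA is freshness with respect to this set.\<close>

definition seen :: "nat \<Rightarrow> 'a \<Rightarrow> ('v, 'w) content set" where
  "seen k a = (\<lambda>j. mem j a) ` {..k}"

text \<open>A thread is idle between two operations, so an unbroken busy period up to
  \<open>k\<close> lies within its current operation.\<close>

definition thread_states :: "nat \<Rightarrow> 't \<Rightarrow> ('a \<Rightarrow> 'v) set" where
  "thread_states k t = {abs_state j |j. j \<le> k \<and> (\<forall>i\<in>{j..k}. control (c i) t \<noteq> Idle)}"

text \<open>Membership in \<open>used\<close> bounds the time from below by the invocation of
  \<open>d\<close>, whichever thread makes the observation. The bound from above comes later, from
  the step that decides the status.\<close>

definition descr_states :: "nat \<Rightarrow> 'd \<Rightarrow> ('a \<Rightarrow> 'v) set" where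
  "descr_states k d = {abs_state j |j. j \<le> k \<and> d \<in> used (c j)}"

text \<open>The times at which a value obtained by readInternal may be observed depend on the operation that
  needs it: a read uses it for itself, an MCAS call may make its descriptor fail with it.\<close>

definition caller_states :: "nat \<Rightarrow> 't \<Rightarrow> ('a, 'w, 'd) read_caller \<Rightarrow> ('a \<Rightarrow> 'v) set" where
  "caller_states k t rc =
     (case rc of From_Read \<Rightarrow> thread_states k t | From_M1 d w ws mc \<Rightarrow> descr_states k d)"

definition mismatch :: "nat \<Rightarrow> 'd \<Rightarrow> bool" where
  "mismatch k d \<longleftrightarrow> (\<exists>s \<in> descr_states k d. \<exists>w \<in> set (words D d). s (address D w) \<noteq> old D w)"

definition settled :: "nat \<Rightarrow> ('v, 'w) content \<Rightarrow> bool" where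
  "settled k x \<longleftrightarrow> (\<forall>w. x = Ptr w \<longrightarrow> stat k (parent D w) \<noteq> ACTIVE)"

text \<open>The claim about the processed words \<open>pre\<close> lapses once the status is
  decided, because their pointers may then be overwritten.\<close>

definition in_loop :: "nat \<Rightarrow> 'd \<Rightarrow> 'w list \<Rightarrow> bool" where
  "in_loop k d ws \<longleftrightarrow> d \<in> used (c k) \<and>
     (\<exists>pre. words D d = pre @ ws \<and>
        (stat k d = ACTIVE \<longrightarrow> (\<forall>x \<in> set pre. mem k (address D x) = Ptr x)))"

primrec read_frames :: "nat \<Rightarrow> ('a, 'w, 'd) read_caller \<Rightarrow> bool"
  and mcas_frames :: "nat \<Rightarrow> ('a, 'w, 'd) mcas_caller \<Rightarrow> bool" where
  "read_frames k From_Read \<longleftrightarrow> True"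
| "read_frames k (From_M1 d w ws mc) \<longleftrightarrow> in_loop k d (w # ws) \<and> mcas_frames k mc"
| "mcas_frames k From_Op \<longleftrightarrow> True"
| "mcas_frames k (From_R3 a self rc) \<longleftrightarrow> frame D a self rc \<and> read_frames k rc"

primrec control_inv :: "nat \<Rightarrow> 't \<Rightarrow> ('a, 'v, 'w, 'd) control \<Rightarrow> bool" where
  "control_inv k t Idle \<longleftrightarrow> True"
| "control_inv k t (R1 a self rc) \<longleftrightarrow> frame D a self rc \<and> read_frames k rc"
| "control_inv k t (R3 a self w rc) \<longleftrightarrow> frame D a self rc \<and> read_frames k rc \<and> Ptr w \<in> seen k a \<and>
     (stat k (parent D w) \<noteq> ACTIVE \<longrightarrow> (\<exists>s \<in> caller_states k t rc. s a = val k (Ptr w)))"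
| "control_inv k t (R4 w rc) \<longleftrightarrow> (\<exists>self. frame D (address D w) self rc) \<and> read_frames k rc \<and>
     Ptr w \<in> seen k (address D w) \<and>
     (stat k (parent D w) \<noteq> ACTIVE \<and> (\<exists>s \<in> caller_states k t rc. s (address D w) = val k (Ptr w))
      \<or> (\<exists>d ws mc. rc = From_M1 d w ws mc))"
| "control_inv k t (Loop d ws mc) \<longleftrightarrow> in_loop k d ws \<and> mcas_frames k mc"
| "control_inv k t (M2 d w ws x v mc) \<longleftrightarrow> in_loop k d (w # ws) \<and> mcas_frames k mc \<and>
     x \<in> seen k (address D w) \<and>
     (x = Ptr w \<or> settled k x \<and> val k x = v \<and> (\<exists>s \<in> descr_states k d. s (address D w) = v))"
| "control_inv k t (M3 d w ws x v mc) \<longleftrightarrow> in_loop k d (w # ws) \<and> mcas_frames k mc \<and>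
     x \<in> seen k (address D w) \<and> x \<noteq> Ptr w \<and>
     settled k x \<and> val k x = v \<and> (\<exists>s \<in> descr_states k d. s (address D w) = v)"
| "control_inv k t (M4 d w ws x mc) \<longleftrightarrow> in_loop k d (w # ws) \<and> mcas_frames k mc \<and>
     x \<in> seen k (address D w) \<and> x \<noteq> Ptr w \<and> settled k x \<and> val k x = old D w"
| "control_inv k t (M5 d w ws x mc) \<longleftrightarrow> in_loop k d (w # ws) \<and> mcas_frames k mc \<and>
     x \<in> seen k (address D w) \<and> x \<noteq> Ptr w \<and> settled k x \<and> val k x = old D w \<and>
     (x = mem k (address D w) \<longrightarrow> Ptr w \<notin> seen k (address D w))"
| "control_inv k t (M6 d b mc) \<longleftrightarrow> mcas_frames k mc \<and> d \<in> used (c k) \<and>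
     (if b then in_loop k d [] else mismatch k d)"
| "control_inv k t (M7 d mc) \<longleftrightarrow> mcas_frames k mc \<and> stat k d \<noteq> ACTIVE"
| "control_inv k t (Done r) \<longleftrightarrow> True"

definition pointer_inv :: "nat \<Rightarrow> 'a \<Rightarrow> 'w \<Rightarrow> bool" where
  "pointer_inv k a w \<longleftrightarrow> address D w = a \<and> parent D w \<in> used (c k) \<and>
     (\<exists>pre ws. words D (parent D w) = pre @ w # ws \<and>
        (stat k (parent D w) = ACTIVE \<longrightarrow>
           (\<forall>x \<in> set (pre @ [w]). mem k (address D x) = Ptr x)))"

definition shared_inv :: "nat \<Rightarrow> bool" where
  "shared_inv k \<longleftrightarrow>
     (\<forall>a w. Ptr w \<in> seen k a \<longrightarrow> pointer_inv k a w) \<and>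
     (\<forall>d. stat k d = SUCCESSFUL \<longrightarrow> (\<forall>w \<in> set (words D d). Ptr w \<in> seen k (address D w))) \<and>
     (\<forall>d. stat k d = FAILED \<longrightarrow> mismatch k d)"

definition inv :: "nat \<Rightarrow> bool" where
  "inv k \<longleftrightarrow> shared_inv k \<and> (\<forall>t. control_inv k t (control (c k) t))"

lemma parent_eq: "w \<in> set (words D d) \<Longrightarrow> parent D w = d"
  using wf by (auto simp: wf_descriptors_def)

lemma address_inj:
  "w \<in> set (words D d) \<Longrightarrow> w' \<in> set (words D d) \<Longrightarrow> address D w = address D w' \<Longrightarrow> w = w'"
  using wf unfolding wf_descriptors_def
  by (metis strict_sorted_iff distinct_map inj_onD)

lemma mem_in_seen [simp]: "mem k a \<in> seen k a"
  by (simp add: seen_def)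

lemma seen_Suc: "seen (Suc k) a = insert (mem (Suc k) a) (seen k a)"
  by (auto simp: seen_def atMost_Suc)

lemma thread_statesI: "control (c k) t \<noteq> Idle \<Longrightarrow> abs_state k \<in> thread_states k t"
  by (auto simp: thread_states_def)

lemma descr_statesI: "d \<in> used (c k) \<Longrightarrow> abs_state k \<in> descr_states k d"
  by (auto simp: descr_states_def)

lemma thread_states_Suc:
  assumes "control (c (Suc k)) t \<noteq> Idle"
  shows "thread_states k t \<subseteq> thread_states (Suc k) t"
  using assms by (fastforce simp: thread_states_def le_Suc_eq)

lemma descr_states_Suc: "descr_states k d \<subseteq> descr_states (Suc k) d"
  by (auto simp: descr_states_def intro: le_SucI)

lemma caller_states_Suc:
  assumes "control (c (Suc k)) t \<noteq> Idle"
  shows "caller_states k t rc \<subseteq> caller_states (Suc k) t rc"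
  using thread_states_Suc[OF assms] descr_states_Suc
  by (auto simp: caller_states_def split: read_caller.splits)

lemma mismatch_Suc: "mismatch k d \<Longrightarrow> mismatch (Suc k) d"
  using descr_states_Suc by (fastforce simp: mismatch_def)

lemma caller_statesI:
  "control (c k) t \<noteq> Idle \<Longrightarrow> read_frames k rc \<Longrightarrow> abs_state k \<in> caller_states k t rc"
  by (cases rc) (auto simp: caller_states_def in_loop_def intro: thread_statesI descr_statesI)

lemma inv_0: "inv 0"
proof -
  have "mem 0 = (\<lambda>a. Plain (s0 a))" "stat 0 = (\<lambda>d. ACTIVE)" "control (c 0) = (\<lambda>t. Idle)"
    by (simp_all add: mem_def stat_def init initial_def)
  then show ?thesis
    by (simp add: inv_def shared_inv_def seen_def)
qed

section \<open>Effect of a single step\<close>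

lemma control_other:
  assumes "k < n" "t \<noteq> thread_of (l k)"
  shows "control (c (Suc k)) t = control (c k) t"
  using step[OF assms(1)] assms(2) by cases auto

lemma used_Suc: "k < n \<Longrightarrow> used (c k) \<subseteq> used (c (Suc k))"
  using step[of k] by (cases; auto)

lemma used_mono:
  assumes "j \<le> k" "k \<le> n"
  shows "used (c j) \<subseteq> used (c k)"
  using assms
proof (induction k rule: dec_induct)
  case (step i)
  then show ?case using used_Suc[of i] by auto
qed simp

lemma tau_cases:
  assumes "k < n" "l k = Tau t"
  shows "exec D (mem k, stat k) (control (c k) t) = ((mem (Suc k), stat (Suc k)), control (c (Suc k)) t)"
    "used (c (Suc k)) = used (c k)" "control (c k) t \<noteq> Idle" "\<nexists>r. control (c k) t = Done r"
  using step[OF assms(1)] assms(2) by (cases; auto simp: mem_def stat_def)+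

lemma non_tau_shared:
  assumes "k < n" "\<nexists>t. l k = Tau t"
  shows "mem (Suc k) = mem k" "stat (Suc k) = stat k"
  using step[OF assms(1)] assms(2) by (cases; auto simp: mem_def stat_def)+

lemma shared_cases:
  assumes "k < n"
  obtains (same) "mem (Suc k) = mem k" "stat (Suc k) = stat k"
  | (cas) t d w ws mc where "control (c k) t = M5 d w ws (mem k (address D w)) mc"
      "mem (Suc k) = (mem k)(address D w := Ptr w)" "stat (Suc k) = stat k"
  | (status) t d b mc where "control (c k) t = M6 d b mc" "stat k d = ACTIVE"
      "mem (Suc k) = mem k" "stat (Suc k) = (stat k)(d := if b then SUCCESSFUL else FAILED)"
proof (cases "\<exists>t. l k = Tau t")
  case True
  then obtain t where t: "l k = Tau t" by blast
  note e = tau_cases[OF assms t]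
  show ?thesis
  proof (cases "control (c k) t")
    case (Loop d ws mc)
    with e(1) that(1) show ?thesis by (cases ws) auto
  next
    case (M5 d w ws x mc)
    show ?thesis
    proof (cases "mem k (address D w) = x")
      case True
      with M5 e(1) show ?thesis by (intro cas[of t d w ws mc]) auto
    next
      case False
      with M5 e(1) show ?thesis by (intro same) auto
    qed
  next
    case (M6 d b mc)
    show ?thesis
    proof (cases "stat k d = ACTIVE")
      case True
      with M6 e(1) show ?thesis by (intro status[of t d b mc]) auto
    next
      case False
      with M6 e(1) show ?thesis by (intro same) auto
    qed
  qed (use e in \<open>auto intro: same\<close>)
next
  case False
  with non_tau_shared[OF assms] that(1) show ?thesis by blast
qed

lemma seenD:
  assumes "shared_inv k" "Ptr w \<in> seen k a"
  shows "address D w = a" "parent D w \<in> used (c k)" "w \<in> set (words D (parent D w))"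
    "stat k (parent D w) = ACTIVE \<Longrightarrow> mem k a = Ptr w"
  using assms unfolding shared_inv_def pointer_inv_def by fastforce+

lemma successful_seen:
  "shared_inv k \<Longrightarrow> stat k d = SUCCESSFUL \<Longrightarrow> w \<in> set (words D d) \<Longrightarrow> Ptr w \<in> seen k (address D w)"
  by (simp add: shared_inv_def)

text \<open>The expected content is the current one, so this CAS is about to succeed. A SUCCESSFUL
  descriptor has all its words in \<open>seen\<close>, which contradicts the freshness of
  \<open>Ptr w\<close>; FAILED remains possible.\<close>

lemma M5_new:
  assumes "inv k" "control (c k) t = M5 d w ws (mem k (address D w)) mc"
  shows "Ptr w \<notin> seen k (address D w)" "mem k (address D w) \<noteq> Ptr w" "settled k (mem k (address D w))"
    "val k (mem k (address D w)) = old D w" "in_loop k d (w # ws)"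
    "w \<in> set (words D d)" "parent D w = d" "stat k d \<noteq> SUCCESSFUL"
proof -
  have *: "control_inv k t (M5 d w ws (mem k (address D w)) mc)" and sh: "shared_inv k"
    using assms by (metis inv_def)+
  then show new: "Ptr w \<notin> seen k (address D w)" "mem k (address D w) \<noteq> Ptr w"
    "settled k (mem k (address D w))" "val k (mem k (address D w)) = old D w" "in_loop k d (w # ws)"
    by simp_all
  then show w: "w \<in> set (words D d)" by (auto simp: in_loop_def)
  then show "parent D w = d" by (rule parent_eq)
  show "stat k d \<noteq> SUCCESSFUL" using successful_seen[OF sh _ w] new(1) by blast
qed

lemma stat_Suc:
  assumes "k < n" "stat k d \<noteq> ACTIVE"
  shows "stat (Suc k) d = stat k d"
  using assms(1) by (cases rule: shared_cases) (use assms(2) in auto)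

text \<open>Contents never recur at an address. Hence a successful CAS at M5 proves that the address
  was left alone since its content was read.\<close>

lemma mem_Suc_new:
  assumes "k < n" "inv k" "mem (Suc k) a \<noteq> mem k a"
  shows "mem (Suc k) a \<notin> seen k a"
  using assms(1)
proof (cases rule: shared_cases)
  case (cas t d w ws mc)
  then show ?thesis using M5_new(1)[OF assms(2) cas(1)] assms(3) by (auto split: if_splits)
qed (use assms(3) in auto)

text \<open>A CAS at M5 expects a settled content, so it cannot remove a pointer of an active
  descriptor.\<close>

lemma mem_Suc_active:
  assumes "k < n" "inv k" "mem k a = Ptr w" "stat k (parent D w) = ACTIVE"
  shows "mem (Suc k) a = Ptr w"
  using assms(1)
proof (cases rule: shared_cases)
  case (cas t d w' ws mc)
  then show ?thesis using M5_new(3)[OF assms(2) cas(1)] assms(3,4) by (auto simp: settled_def)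
qed (use assms(3) in auto)

section \<open>Preservation of the invariants\<close>

lemma settled_Suc:
  assumes "k < n" "settled k x"
  shows "settled (Suc k) x" "val (Suc k) x = val k x"
  using assms stat_Suc by (cases x; auto simp: settled_def val_def)+

lemma in_loop_Suc:
  assumes "k < n" "inv k" "in_loop k d ws"
  shows "in_loop (Suc k) d ws"
proof -
  obtain pre where pre: "words D d = pre @ ws"
    "stat k d = ACTIVE \<longrightarrow> (\<forall>x \<in> set pre. mem k (address D x) = Ptr x)"
    using assms(3) by (auto simp: in_loop_def)
  have "mem (Suc k) (address D x) = Ptr x" if "stat (Suc k) d = ACTIVE" "x \<in> set pre" for x
  proof -
    have "stat k d = ACTIVE" using stat_Suc[OF assms(1)] that(1) by metis
    moreover have "parent D x = d" using pre(1) that(2) by (intro parent_eq) simp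
    ultimately show ?thesis using pre(2) that(2) mem_Suc_active[OF assms(1,2)] by blast
  qed
  then show ?thesis using pre(1) assms(3) used_Suc[OF assms(1)] by (auto simp: in_loop_def)
qed

lemma frames_Suc:
  assumes "k < n" "inv k"
  shows "read_frames k rc \<Longrightarrow> read_frames (Suc k) rc"
    "mcas_frames k mc \<Longrightarrow> mcas_frames (Suc k) mc"
  by (induction rc and mc) (auto intro: in_loop_Suc[OF assms])

text \<open>The control state of a thread stays consistent when time advances, be it because other threads
  move or because the thread itself is about to continue from it.\<close>

lemma control_inv_Suc:
  assumes "k < n" "inv k" "control (c k) t = X" "control (c (Suc k)) t \<noteq> Idle"
  shows "control_inv (Suc k) t X"
proof -
  have X: "control_inv k t X" and sh: "shared_inv k" using assms(2,3) by (auto simp: inv_def)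
  note mono = in_loop_Suc[OF assms(1,2)] frames_Suc[OF assms(1,2)] settled_Suc[OF assms(1)]
    subsetD[OF descr_states_Suc] subsetD[OF caller_states_Suc[OF assms(4)]] stat_Suc[OF assms(1)]
    subsetD[OF used_Suc[OF assms(1)]]
  have val: "val (Suc k) (Ptr w) = val k (Ptr w)" if "stat k (parent D w) \<noteq> ACTIVE" for w
    using that mono(5)[of "Ptr w"] by (simp add: settled_def)
  show ?thesis
  proof (cases X)
    case (R3 a self w rc)
    have "\<exists>s \<in> caller_states (Suc k) t rc. s a = val (Suc k) (Ptr w)"
      if st: "stat (Suc k) (parent D w) \<noteq> ACTIVE"
    \<comment> \<open>If this very step decides the status, the pointer is still in memory
      afterwards and the state right after the step is the witness. If the status was decided
      before, the earlier witness persists.\<close>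
    proof (cases "stat k (parent D w) = ACTIVE")
      case True
      then have "mem k a = Ptr w" using X R3 seenD(4)[OF sh] by auto
      then have "abs_state (Suc k) a = val (Suc k) (Ptr w)"
        using mem_Suc_active[OF assms(1,2)] True by (auto simp: abs_state_def)
      moreover have "abs_state (Suc k) \<in> caller_states (Suc k) t rc"
        using X R3 mono(2) assms(4) by (intro caller_statesI) auto
      ultimately show ?thesis by blast
    next
      case False
      then obtain s where "s \<in> caller_states k t rc" "s a = val k (Ptr w)"
        using X R3 by auto
      then show ?thesis using val[OF False] mono(7) by auto
    qed
    then show ?thesis using X R3 mono by (simp add: seen_Suc)
  next
    case (R4 w rc)
    then show ?thesis using X mono(2,7,8) val by (auto simp: seen_Suc)
  next
    case (M5 d w ws x mc)
    then show ?thesis using X mono mem_Suc_new[OF assms(1,2)]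
      by (simp add: seen_Suc) metis
  next
    case (M2 d w ws x v mc)
    then show ?thesis using X mono by (auto simp: seen_Suc)
  next
    case (M3 d w ws x v mc)
    then show ?thesis using X mono by (auto simp: seen_Suc)
  next
    case (M4 d w ws x mc)
    then show ?thesis using X mono by (auto simp: seen_Suc)
  next
    case (M6 d b mc)
    then show ?thesis using X mono mismatch_Suc by (auto split: if_splits)
  qed (use X mono in auto)
qed

lemma shared_inv_Suc:
  assumes "k < n" "inv k"
  shows "shared_inv (Suc k)"
proof -
  have sh: "shared_inv k" using assms(2) by (simp add: inv_def)
  have old: "pointer_inv (Suc k) a w" if "Ptr w \<in> seen k a" for w a
  proof -
    obtain pre ws where *: "address D w = a" "parent D w \<in> used (c k)"
      "words D (parent D w) = pre @ w # ws"
      "stat k (parent D w) = ACTIVE \<longrightarrow> (\<forall>x \<in> set (pre @ [w]). mem k (address D x) = Ptr x)"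
      using sh \<open>Ptr w \<in> seen k a\<close> unfolding shared_inv_def pointer_inv_def by blast
    \<comment> \<open>The prefix ending in \<open>w\<close> has the form of the processed part of a
      loop, so its persistence is already known.\<close>
    have "in_loop k (parent D w) ws"
      unfolding in_loop_def using * by (intro conjI exI[of _ "pre @ [w]"]) auto
    from in_loop_Suc[OF assms this] show ?thesis
      using *(1,3) unfolding in_loop_def pointer_inv_def by auto
  qed
  have succ: "Ptr w \<in> seen (Suc k) (address D w)"
    if "stat k d = SUCCESSFUL" "w \<in> set (words D d)" for d w
    using successful_seen[OF sh that] by (simp add: seen_Suc)
  have fail: "mismatch (Suc k) d" if "stat k d = FAILED" for d
    using sh that mismatch_Suc by (simp add: shared_inv_def)
  show ?thesis
    using assms(1)
  proof (cases rule: shared_cases)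
    case same
    then have "seen (Suc k) = seen k" by (simp add: fun_eq_iff seen_Suc insert_absorb)
    with same show ?thesis using old succ fail by (simp add: shared_inv_def)
  next
    case (cas t d w ws mc)
    note new = M5_new[OF assms(2) cas(1)]
    have seen: "seen (Suc k) a = (if a = address D w then insert (Ptr w) (seen k a) else seen k a)" for a
      by (simp add: seen_Suc cas(2) insert_absorb)
    obtain pre where pre: "words D d = pre @ w # ws"
      "stat k d = ACTIVE \<longrightarrow> (\<forall>x \<in> set pre. mem k (address D x) = Ptr x)" "d \<in> used (c k)"
      using new(5) by (auto simp: in_loop_def)
    have "mem (Suc k) (address D x) = Ptr x" if "stat (Suc k) d = ACTIVE" "x \<in> set (pre @ [w])" for x
    proof (cases "x = w")
      case True
      then show ?thesis by (simp add: cas(2))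
    next
      case False
      then have "address D x \<noteq> address D w" using address_inj[of x d w] pre(1) that(2) by auto
      then show ?thesis using that False pre(2) cas(3) by (auto simp: cas(2))
    qed
    with pre new(7) used_Suc[OF assms(1)] have "pointer_inv (Suc k) (address D w) w"
      unfolding pointer_inv_def by blast
    then have "pointer_inv (Suc k) a w'" if "Ptr w' \<in> seen (Suc k) a" for w' a
      using that old by (auto simp: seen split: if_splits)
    then show ?thesis using succ fail cas(3) by (simp add: shared_inv_def)
  next
    case (status t d b mc)
    then have seen: "seen (Suc k) = seen k" by (simp add: fun_eq_iff seen_Suc insert_absorb)
    have ci: "control_inv k t (M6 d b mc)" using assms(2) status(1) by (metis inv_def)
    have "Ptr w \<in> seen (Suc k) (address D w)" if "b" "w \<in> set (words D d)" for w
      using ci that status(2) mem_in_seen[of k "address D w"] by (auto simp: in_loop_def seen)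
    moreover have "mismatch (Suc k) d" if "\<not> b" using ci that mismatch_Suc by simp
    ultimately show ?thesis
      using old succ fail by (auto simp: shared_inv_def status(4) seen split: if_splits)
  qed
qed

lemma seenD_active_loop:
  assumes "shared_inv k" "Ptr w \<in> seen k a"
  shows "in_loop k (parent D w) (words D (parent D w))"
  using seenD(2)[OF assms] by (simp add: in_loop_def)

lemma return_readInternal_inv:
  assumes "frame D a self rc" "read_frames k rc" "x \<in> seen k a"
    and "\<And>d w ws mc. rc = From_M1 d w ws mc \<Longrightarrow> x \<noteq> Ptr w \<Longrightarrow>
      settled k x \<and> val k x = v \<and> (\<exists>s \<in> descr_states k d. s a = v)"
  shows "control_inv k t (return_readInternal x v rc)"
  using assms by (cases rc) auto

lemma return_not_Idle [simp]:
  "return_readInternal x v rc \<noteq> Idle" "return_MCAS b mc \<noteq> Idle"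
  by (cases rc; simp) (cases mc; simp)

lemma exec_not_Idle: "X \<noteq> Idle \<Longrightarrow> snd (exec E sh X) \<noteq> Idle"
  by (induction E sh X rule: exec.induct) (auto simp: Let_def split: content.splits)

text \<open>The clause of the old control state is first moved to time \<open>Suc k\<close> (fact
  \<open>ci\<close>), which absorbs the change of the shared memory; only the move of the control
  then remains.\<close>

lemma control_inv_exec:
  assumes "k < n" "inv k" "l k = Tau t"
  shows "control_inv (Suc k) t (control (c (Suc k)) t)"
proof -
  note e = tau_cases[OF assms(1,3)]
  have next_control: "control (c (Suc k)) t = snd (exec D (mem k, stat k) (control (c k) t))"
    using e(1) by simp
  have sh: "shared_inv (Suc k)" using shared_inv_Suc[OF assms(1,2)] .
  have non_idle: "control (c (Suc k)) t \<noteq> Idle"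
    using exec_not_Idle[OF e(3), of D "(mem k, stat k)"] e(1) by simp
  have ci: "control_inv (Suc k) t (control (c k) t)"
    using control_inv_Suc[OF assms(1,2) refl non_idle] .
  show ?thesis
  proof (cases "control (c k) t")
    case (R1 a self rc)
    with e(1) have same: "mem (Suc k) = mem k" "stat (Suc k) = stat k" by auto
    show ?thesis
    proof (cases "mem k a")
      case (Plain v)
      have "abs_state (Suc k) a = v" by (simp add: abs_state_def same Plain val_def)
      moreover have "abs_state (Suc k) \<in> caller_states (Suc k) t rc"
        using ci R1 non_idle by (intro caller_statesI) auto
      moreover have "Plain v \<in> seen (Suc k) a" using mem_in_seen[of "Suc k" a] same Plain by simp
      ultimately have "control_inv (Suc k) t (return_readInternal (Plain v) v rc)"
        using ci R1 
        by (intro return_readInternal_inv[where a = a and self = self])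
          (auto simp: settled_def val_def caller_states_def)
      then show ?thesis using R1 next_control Plain by auto
    next
      case (Ptr w)
      have "abs_state (Suc k) a = val (Suc k) (Ptr w)" by (simp add: abs_state_def same Ptr)
      moreover have "abs_state (Suc k) \<in> caller_states (Suc k) t rc"
        using ci R1 non_idle by (intro caller_statesI) auto
      moreover have "Ptr w \<in> seen (Suc k) a" using mem_in_seen[of "Suc k" a] same Ptr by simp
      moreover have "control (c (Suc k)) t = R3 a self w rc" using R1 next_control Ptr by simp
      ultimately show ?thesis using R1 ci by auto
    qed
  next
    case (R3 a self w rc)
    with e(1) have same: "mem (Suc k) = mem k" "stat (Suc k) = stat k" by auto
    have a: "address D w = a" using ci R3 seenD(1)[OF sh] by simp
    show ?thesis
    proof (cases "Some (parent D w) \<noteq> self \<and> stat k (parent D w) = ACTIVE")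
      case True
      then have "control (c (Suc k)) t = Loop (parent D w) (words D (parent D w)) (From_R3 a self rc)"
        using R3 next_control by (simp add: Let_def)
      then show ?thesis using R3 ci seenD_active_loop[OF sh, of w a] by simp
    next
      case False
      then have "control (c (Suc k)) t = R4 w rc" using R3 next_control by (auto simp: Let_def)
      \<comment> \<open>R4 is entered with an active descriptor only if it is the caller's own. As
        addresses within a descriptor are distinct, the pointer found is then the one to the target
        word.\<close>
      moreover have "w' = w" if "rc = From_M1 d w' ws mc" "parent D w = d" for d w' ws mc
        using seenD(3)[OF sh, of w a] that a R3 ci
        by (intro address_inj[of w' d w]) (auto simp: in_loop_def)
      ultimately show ?thesis using False R3 ci a same by (cases rc) auto
    qed
  next
    case (R4 w rc)
    with e(1) have same: "mem (Suc k) = mem k" "stat (Suc k) = stat k" by auto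
    have v: "(if stat k (parent D w) = SUCCESSFUL then new D w else old D w) = val (Suc k) (Ptr w)"
      by (simp add: val_def same)
    obtain self where fr: "frame D (address D w) self rc" using ci R4 by auto
    have "control_inv (Suc k) t (return_readInternal (Ptr w) (val (Suc k) (Ptr w)) rc)"
    proof (rule return_readInternal_inv[OF fr])
      fix d w' ws mc
      assume rc: "rc = From_M1 d w' ws mc" "Ptr w \<noteq> (Ptr w' :: ('v, 'w) content)"
      show "settled (Suc k) (Ptr w) \<and> val (Suc k) (Ptr w) = val (Suc k) (Ptr w) \<and>
        (\<exists>s \<in> descr_states (Suc k) d. s (address D w) = val (Suc k) (Ptr w))"
        using R4 ci rc by (auto simp: settled_def caller_states_def)
    qed (use ci R4 in auto)
    then show ?thesis using R4 next_control v by auto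
  next
    case (Loop d ws mc)
    then show ?thesis using next_control ci by (cases ws) (auto simp: in_loop_def)
  next
    case (M2 d w ws x v mc)
    have "in_loop (Suc k) d ws" if "x = Ptr w"
    proof -
      obtain pre where pre: "words D d = pre @ w # ws"
        "stat (Suc k) d = ACTIVE \<longrightarrow> (\<forall>x \<in> set pre. mem (Suc k) (address D x) = Ptr x)" "d \<in> used (c (Suc k))"
        using M2 ci by (auto simp: in_loop_def)
      have "parent D w = d" using pre(1) by (intro parent_eq) simp
      \<comment> \<open>The pointer was read at some earlier time, but while its descriptor is
        active it is not overwritten.\<close>
      then have "mem (Suc k) (address D w) = Ptr w" if "stat (Suc k) d = ACTIVE"
        using seenD(4)[OF sh, of w "address D w"] that ci M2 \<open>x = Ptr w\<close> by simp
      then show ?thesis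
        unfolding in_loop_def using pre by (intro conjI exI[of _ "pre @ [w]"]) auto
    qed
    then show ?thesis using M2 next_control ci by auto
  next
    case (M3 d w ws x v mc)
    have "d \<in> used (c (Suc k))" using ci M3 by (simp add: in_loop_def)
    moreover have "mismatch (Suc k) d" if "v \<noteq> old D w"
    proof -
      have "w \<in> set (words D d)" using ci M3 by (auto simp: in_loop_def)
      moreover obtain s where "s \<in> descr_states (Suc k) d" "s (address D w) = v"
        using ci unfolding M3 by auto
      ultimately show ?thesis using that unfolding mismatch_def by blast
    qed
    ultimately show ?thesis using M3 next_control ci by auto
  next
    case (M4 d w ws x mc)
    with e(1) have same: "mem (Suc k) = mem k" "stat (Suc k) = stat k" by auto
    have w: "parent D w = d" "d \<in> used (c (Suc k))"
      using M4 ci by (auto simp: in_loop_def intro!: parent_eq)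
    show ?thesis
    proof (cases "stat k d = ACTIVE")
      case True
      \<comment> \<open>An earlier installation of \<open>w\<close> would still be in memory. Since
        \<open>x\<close> differs from \<open>Ptr w\<close>, this is incompatible with
        \<open>x\<close> being the current content.\<close>
      then have "Ptr w \<in> seen (Suc k) (address D w) \<Longrightarrow> mem (Suc k) (address D w) = Ptr w"
        using seenD(4)[OF sh] w same by metis
      then show ?thesis using M4 next_control ci True by auto
    next
      case False
      \<comment> \<open>The exit at M4 keeps \<open>success\<close> true although words may be
        missing. The claim about them is vacuous for a decided status, and the CAS at M6 will have
        no effect.\<close>
      then have "in_loop (Suc k) d []" using w same by (auto simp: in_loop_def)
      then show ?thesis using M4 next_control ci False w by auto
    qed
  next
    case (M5 d w ws x mc)
    show ?thesis
    proof (cases "mem k (address D w) = x")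
      case True
      with M5 e(1) have m: "mem (Suc k) = (mem k)(address D w := Ptr w)" "stat (Suc k) = stat k"
        "control (c (Suc k)) t = Loop d ws mc" by auto
      obtain pre where pre: "words D d = pre @ w # ws"
        "stat (Suc k) d = ACTIVE \<longrightarrow> (\<forall>x \<in> set pre. mem (Suc k) (address D x) = Ptr x)" "d \<in> used (c (Suc k))"
        using M5 ci by (auto simp: in_loop_def)
      then have "in_loop (Suc k) d ws"
        unfolding in_loop_def using m by (intro conjI exI[of _ "pre @ [w]"]) auto
      then show ?thesis using m ci M5 by auto
    next
      case False
      with M5 next_control have "control (c (Suc k)) t = Loop d (w # ws) mc" by auto
      then show ?thesis using ci M5 by auto
    qed
  next
    case (M6 d b mc)
    have "stat (Suc k) =
        (if stat k d = ACTIVE then (stat k)(d := if b then SUCCESSFUL else FAILED) else stat k)"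
      using e(1) M6 by simp
    then have "stat (Suc k) d \<noteq> ACTIVE" by simp
    then show ?thesis using next_control M6 ci by auto
  next
    case (M7 d mc)
    then show ?thesis using next_control ci by (cases mc) auto
  qed (use e(3,4) in auto)
qed

lemma inv_Suc:
  assumes "k < n" "inv k"
  shows "inv (Suc k)"
  unfolding inv_def
proof (intro conjI allI)
  show "shared_inv (Suc k)" using assms by (rule shared_inv_Suc)
  fix t
  show "control_inv (Suc k) t (control (c (Suc k)) t)"
  proof (cases "t = thread_of (l k)")
    case False
    then have "control (c (Suc k)) t = control (c k) t" by (rule control_other[OF assms(1)])
    then show ?thesis using control_inv_Suc[OF assms refl, of t] by (cases "control (c k) t = Idle") auto
  next
    case True
    show ?thesis
      using step[OF assms(1)]
    proof cases
      case (invoke_read t a)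
      then show ?thesis using True by simp
    next
      case (invoke_MCAS t d)
      then show ?thesis using True by (simp add: in_loop_def)
    next
      case (internal t sh k)
      then show ?thesis using True control_inv_exec[OF assms] by simp
    next
      case (respond t r)
      then show ?thesis using True by simp
    qed
  qed
qed

lemma inv: "k \<le> n \<Longrightarrow> inv k"
  by (induction k) (auto intro: inv_0 inv_Suc)

end

section \<open>Linearization points\<close>

lemma fold_update_notin:
  "a \<notin> fst ` set ts \<Longrightarrow> fold (\<lambda>(a, e, v) s. s(a := v)) ts s a = s a"
  by (induction ts arbitrary: s) auto

lemma fold_update_in:
  assumes "distinct (map fst ts)" "(a, e, v) \<in> set ts"
  shows "fold (\<lambda>(a, e, v) s. s(a := v)) ts s a = v"
  using assms
proof (induction ts arbitrary: s)
  case (Cons t ts)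
  show ?case
  proof (cases "(a, e, v) = t")
    case True
    then have "a \<notin> fst ` set ts" using Cons.prems(1) unfolding True[symmetric] by simp
    then have "fold (\<lambda>(a, e, v) s. s(a := v)) ts (s(a := v)) a = v"
      by (subst fold_update_notin) simp_all
    then show ?thesis unfolding True[symmetric] fold_simps prod.case .
  next
    case False
    then show ?thesis using Cons by simp
  qed
qed simp

text \<open>An operation is represented by the address it reads or by the descriptor of its MCAS.\<close>

primrec read_op :: "'a \<Rightarrow> ('a, 'w, 'd) read_caller \<Rightarrow> 'a + 'd"
  and mcas_op :: "'d \<Rightarrow> ('a, 'w, 'd) mcas_caller \<Rightarrow> 'a + 'd" where
  "read_op a From_Read = Inl a"
| "read_op a (From_M1 d w ws mc) = mcas_op d mc"
| "mcas_op d From_Op = Inr d"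
| "mcas_op d (From_R3 a self rc) = read_op a rc"

text \<open>The operation at the bottom of the call stack, which helping does not change.
  \<open>Done\<close> keeps only the result, so there \<open>executing\<close> constrains the result
  instead.\<close>

primrec root_op ::
  "('a, 'v, 'w, 'd) descriptors \<Rightarrow> ('a, 'v, 'w, 'd) control \<Rightarrow> ('a + 'd) option" where
  "root_op D Idle = None"
| "root_op D (R1 a self rc) = Some (read_op a rc)"
| "root_op D (R3 a self w rc) = Some (read_op a rc)"
| "root_op D (R4 w rc) = Some (read_op (address D w) rc)"
| "root_op D (Loop d ws mc) = Some (mcas_op d mc)"
| "root_op D (M2 d w ws x v mc) = Some (mcas_op d mc)"
| "root_op D (M3 d w ws x v mc) = Some (mcas_op d mc)"
| "root_op D (M4 d w ws x mc) = Some (mcas_op d mc)"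
| "root_op D (M5 d w ws x mc) = Some (mcas_op d mc)"
| "root_op D (M6 d b mc) = Some (mcas_op d mc)"
| "root_op D (M7 d mc) = Some (mcas_op d mc)"
| "root_op D (Done r) = None"

definition op_label :: "('a, 'v, 'w, 'd) descriptors \<Rightarrow> 'a + 'd \<Rightarrow> ('a, 'v) mop" where
  "op_label D x = (case x of Inl a \<Rightarrow> Read_Op a | Inr d \<Rightarrow> MCAS_Op (tuples D d))"

lemma mcas_spec_update:
  assumes "wf_descriptors D"
    and "\<And>w. w \<in> set (words D d) \<Longrightarrow> s (address D w) = old D w"
    and "\<And>w. w \<in> set (words D d) \<Longrightarrow> s' (address D w) = new D w"
    and "\<And>a. a \<notin> address D ` set (words D d) \<Longrightarrow> s' a = s a"
  shows "mcas_spec s (MCAS_Op (tuples D d)) = (s', Flag True)"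
proof -
  have dist: "distinct (map fst (tuples D d))"
    using assms(1) by (simp add: wf_descriptors_def tuples_def strict_sorted_iff comp_def)
  have "fold (\<lambda>(a, e, v) s. s(a := v)) (tuples D d) s a = s' a" for a
  proof (cases "a \<in> address D ` set (words D d)")
    case True
    then obtain w where w: "w \<in> set (words D d)" "a = address D w" by blast
    then have "(a, old D w, new D w) \<in> set (tuples D d)" by (auto simp: tuples_def)
    then show ?thesis using fold_update_in[OF dist] w assms(3) by metis
  next
    case False
    then show ?thesis using assms(4) by (subst fold_update_notin) (force simp: tuples_def)+
  qed
  then show ?thesis using assms(2) by (auto simp: tuples_def fun_eq_iff)
qed

section \<open>Changes of the represented state\<close>

context execution
begin

text \<open>ACTIVE and FAILED both select \<open>old\<close>, so deciding FAILED changes no value.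
  Installing a pointer changes none either, as it replaces a content of value \<open>old D w\<close>
  and its descriptor is not SUCCESSFUL.\<close>

lemma abs_state_Suc:
  assumes "k < n" "abs_state (Suc k) \<noteq> abs_state k"
  obtains d where "stat k d = ACTIVE" "stat (Suc k) d = SUCCESSFUL"
proof -
  have "inv k" using assms(1) inv by simp
  show ?thesis
    using assms(1)
  proof (cases rule: shared_cases)
    case same
    then have "abs_state (Suc k) = abs_state k" by (intro ext) (simp add: abs_state_def val_def)
    then show ?thesis using assms(2) by simp
  next
    case (cas t d w ws mc)
    have "abs_state (Suc k) a = abs_state k a" for a
      using M5_new[OF \<open>inv k\<close> cas(1)] by (auto simp: abs_state_def val_def cas(2,3))
    then show ?thesis using assms(2) by auto
  next
    case (status t d b mc)
    show ?thesis
    proof (cases b)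
      case True
      then show ?thesis using status that[of d] by simp
    next
      case False
      have "val (Suc k) x = val k x" for x
        using False status by (cases x) (auto simp: val_def)
      then show ?thesis using assms(2) status(3) by (simp add: abs_state_def fun_eq_iff)
    qed
  qed
qed

text \<open>The descriptor is still ACTIVE with its loop completed, so all its words are in memory
  and the new status switches exactly these from \<open>old\<close> to \<open>new\<close>. The last
  claim makes the descriptor recoverable from the step.\<close>

lemma successful_step:
  assumes "k < n" "stat k d = ACTIVE" "stat (Suc k) d = SUCCESSFUL"
  shows "d \<in> used (c k)"
    and "mcas_spec (abs_state k) (MCAS_Op (tuples D d)) = (abs_state (Suc k), Flag True)"
    and "d' \<noteq> d \<Longrightarrow> stat (Suc k) d' = stat k d'"
proof -
  have "inv k" using assms(1) inv by simp
  obtain t mc where M6: "control (c k) t = M6 d True mc" "mem (Suc k) = mem k"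
    "stat (Suc k) = (stat k)(d := SUCCESSFUL)"
    using assms(1)
  proof (cases rule: shared_cases)
    case (status t d' b mc)
    then show ?thesis using that assms(2,3) by (cases "d' = d") (auto split: if_splits)
  qed (use assms(2,3) in auto)
  have ci: "control_inv k t (M6 d True mc)" and sh: "shared_inv k"
    using M6(1) \<open>inv k\<close> by (metis inv_def)+
  then show "d \<in> used (c k)" by simp
  show "d' \<noteq> d \<Longrightarrow> stat (Suc k) d' = stat k d'" using M6(3) by simp
  have installed: "mem k (address D w) = Ptr w" "parent D w = d" if "w \<in> set (words D d)" for w
    using ci that assms(2) parent_eq by (auto simp: in_loop_def)
  show "mcas_spec (abs_state k) (MCAS_Op (tuples D d)) = (abs_state (Suc k), Flag True)"
  proof (rule mcas_spec_update[OF wf])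
    fix a
    assume a: "a \<notin> address D ` set (words D d)"
    show "abs_state (Suc k) a = abs_state k a"
    proof (cases "mem k a")
      case (Ptr w)
      then have "address D w = a" "w \<in> set (words D (parent D w))"
        using seenD(1,3)[OF sh, of w a] mem_in_seen[of k a] by auto
      \<comment> \<open>A pointer only sits at the address of its own word, so away from the
        addresses of \<open>d\<close> no content depends on its status.\<close>
      then have "parent D w \<noteq> d" using a by auto
      then show ?thesis using Ptr by (simp add: abs_state_def val_def M6)
    qed (simp add: abs_state_def val_def M6)
  qed (use installed assms(2) in \<open>simp_all add: abs_state_def val_def M6\<close>)
qed

lemma mismatch_spec:
  assumes "mismatch k d"
  obtains j where "j \<le> k" "d \<in> used (c j)"
    "mcas_spec (abs_state j) (MCAS_Op (tuples D d)) = (abs_state j, Flag False)"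
proof -
  obtain j w where "j \<le> k" "d \<in> used (c j)" "w \<in> set (words D d)" "abs_state j (address D w) \<noteq> old D w"
    using assms by (auto simp: mismatch_def descr_states_def)
  moreover from this have "mcas_spec (abs_state j) (MCAS_Op (tuples D d)) = (abs_state j, Flag False)"
    by (force simp: tuples_def)
  ultimately show ?thesis using that by blast
qed

lemma stat_persistent:
  assumes "i \<le> k" "k \<le> n" "stat i d \<noteq> ACTIVE"
  shows "stat k d = stat i d"
  using assms
proof (induction k rule: dec_induct)
  case (step m)
  then show ?case using stat_Suc[of m d] by simp
qed simp

lemma status_step_unique:
  assumes "i < n" "stat i d = ACTIVE" "stat (Suc i) d \<noteq> ACTIVE"
    and "j < n" "stat j d = ACTIVE" "stat (Suc j) d \<noteq> ACTIVE"
  shows "i = j"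
  using assms stat_persistent[of "Suc i" j d] stat_persistent[of "Suc j" i d]
  by (metis Suc_leI less_imp_le linorder_neqE_nat)

lemma status_decided:
  assumes "k \<le> n" "stat k d \<noteq> ACTIVE"
  obtains j where "j < k" "stat j d = ACTIVE" "stat (Suc j) d \<noteq> ACTIVE"
    "\<forall>i. Suc j \<le> i \<longrightarrow> i \<le> n \<longrightarrow> stat i d = stat (Suc j) d"
    "\<forall>i. stat i d \<noteq> ACTIVE \<longrightarrow> Suc j \<le> i"
proof -
  define i where "i = (LEAST i. stat i d \<noteq> ACTIVE)"
  have i: "stat i d \<noteq> ACTIVE" "i \<le> k"
    unfolding i_def
    using LeastI[of "\<lambda>i. stat i d \<noteq> ACTIVE"] Least_le[of "\<lambda>i. stat i d \<noteq> ACTIVE"] assms(2) by blast+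
  have least: "i \<le> i'" if "stat i' d \<noteq> ACTIVE" for i'
    unfolding i_def using that by (rule Least_le)
  have "stat 0 d = ACTIVE" by (simp add: stat_def init initial_def)
  then obtain j where j: "i = Suc j" using i(1) by (cases i) auto
  have const: "stat i' d = stat i d" if "i \<le> i'" "i' \<le> n" for i'
    using stat_persistent that i(1) .
  show ?thesis
  proof (rule that[of j])
    show "stat j d = ACTIVE" using least[of j] j by auto
    show "\<forall>i. Suc j \<le> i \<longrightarrow> i \<le> n \<longrightarrow> stat i d = stat (Suc j) d" using const j by blast
  qed (use i j least in auto)
qed

section \<open>Operations, their intervals and results\<close>

definition result_ok :: "nat \<Rightarrow> 't \<Rightarrow> 'a + 'd \<Rightarrow> 'v result \<Rightarrow> bool" where
  "result_ok k t x r \<longleftrightarrow>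
     (case x of Inl a \<Rightarrow> \<exists>s \<in> thread_states k t. r = Value (s a)
      | Inr d \<Rightarrow> stat k d \<noteq> ACTIVE \<and> r = Flag (stat k d = SUCCESSFUL))"

definition executing :: "nat \<Rightarrow> 't \<Rightarrow> 'a + 'd \<Rightarrow> bool" where
  "executing k t x \<longleftrightarrow> root_op D (control (c k) t) = Some x \<or>
     (\<exists>r. control (c k) t = Done r \<and> result_ok k t x r)"

lemma result_ok_Suc:
  assumes "k < n" "control (c (Suc k)) t \<noteq> Idle" "result_ok k t x r"
  shows "result_ok (Suc k) t x r"
proof (cases x)
  case (Inl a)
  then show ?thesis
    using assms(3) subsetD[OF thread_states_Suc[OF assms(2)]] by (auto simp: result_ok_def)
next
  case (Inr d)
  then show ?thesis using assms(3) stat_Suc[OF assms(1), of d] by (auto simp: result_ok_def)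
qed

lemma executing_tau:
  assumes "k < n" "executing k t x" "l k = Tau t"
  shows "executing (Suc k) t x"
proof -
  note e = tau_cases[OF assms(1,3)]
  have root: "root_op D (control (c k) t) = Some x"
    using assms(2) e(4) by (auto simp: executing_def)
  have invk: "shared_inv k" "control_inv k t (control (c k) t)"
    using inv[of k] assms(1) by (auto simp: inv_def)
  have next_control: "control (c (Suc k)) t = snd (exec D (mem k, stat k) (control (c k) t))"
    using e(1) by simp
  have non_idle: "control (c (Suc k)) t \<noteq> Idle"
    using exec_not_Idle[OF e(3), of D "(mem k, stat k)"] e(1) by simp
  show ?thesis
  proof (cases "control (c k) t")
    case (R1 a self rc)
    show ?thesis
    proof (cases "mem k a")
      case (Plain v)
      have "abs_state k \<in> thread_states (Suc k) t"
        using thread_statesI[OF e(3)] thread_states_Suc[OF non_idle] by auto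
      moreover have "abs_state k a = v" by (simp add: abs_state_def val_def Plain)
      ultimately show ?thesis
        using R1 Plain next_control root by (cases rc) (auto simp: executing_def result_ok_def)
    next
      case (Ptr w)
      then show ?thesis using R1 next_control root by (simp add: executing_def)
    qed
  next
    case (R3 a self w rc)
    \<comment> \<open>\<open>R4\<close> no longer carries the address, and \<open>root_op\<close>
      recovers it from the pointer.\<close>
    then have "address D w = a" using invk seenD(1)[of k w a] by simp
    then show ?thesis using R3 next_control root by (simp add: executing_def Let_def)
  next
    case (R4 w rc)
    show ?thesis
    proof (cases rc)
      case From_Read
      then obtain s where "s \<in> thread_states k t" "val k (Ptr w) = s (address D w)"
        using R4 invk(2) by (force simp: caller_states_def)
      moreover have "control (c (Suc k)) t = Done (Value (val k (Ptr w)))"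
        using R4 From_Read next_control by (simp add: val_def)
      ultimately show ?thesis
        using R4 From_Read root thread_states_Suc[OF non_idle]
        unfolding executing_def by (auto simp: result_ok_def intro!: bexI[of _ s])
    next
      case (From_M1 d w' ws mc)
      then show ?thesis using R4 next_control root by (simp add: executing_def)
    qed
  next
    case (Loop d ws mc)
    then show ?thesis using next_control root by (cases ws) (auto simp: executing_def)
  next
    case (M7 d mc)
    have "stat (Suc k) = stat k" using M7 e(1) by simp
    then show ?thesis
      using M7 next_control root invk(2) by (cases mc) (auto simp: executing_def result_ok_def)
  qed (use next_control root in \<open>auto simp: executing_def\<close>)
qed

lemma executing_Suc:
  assumes "k < n" "executing k t x" "thread_of (l k) = t \<Longrightarrow> l k = Tau t"
  shows "executing (Suc k) t x"
proof (cases "thread_of (l k) = t")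
  case True
  then show ?thesis using executing_tau assms by blast
next
  case False
  then have same: "control (c (Suc k)) t = control (c k) t" using control_other assms(1) by metis
  have "control (c k) t \<noteq> Idle" using assms(2) by (auto simp: executing_def)
  then show ?thesis
    using assms(2) result_ok_Suc[OF assms(1), of t] same by (auto simp: executing_def)
qed

text \<open>Different descriptors may have equal tuples, so the label does not determine the
  operation. The descriptor entering \<open>used\<close> does.\<close>

definition invocation :: "nat \<Rightarrow> 't \<Rightarrow> 'a + 'd \<Rightarrow> bool" where
  "invocation p t x \<longleftrightarrow> p < n \<and> l p = Inv t (op_label D x) \<and> control (c p) t = Idle \<and>
     executing (Suc p) t x \<and> (\<forall>d. x = Inr d \<longleftrightarrow> d \<in> used (c (Suc p)) \<and> d \<notin> used (c p))"

lemma invocation_exists: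
  assumes "p < n" "l p = Inv t y"
  shows "\<exists>x. invocation p t x"
  using step[OF assms(1)]
proof cases
  case (invoke_read t a)
  then show ?thesis
    using assms by (intro exI[of _ "Inl a"]) (auto simp: invocation_def op_label_def executing_def)
next
  case (invoke_MCAS t d)
  then show ?thesis
    using assms by (intro exI[of _ "Inr d"]) (auto simp: invocation_def op_label_def executing_def)
qed (use assms in auto)

lemma used_invoked:
  assumes "k \<le> n" "d \<in> used (c k)"
  shows "\<exists>p t. p < k \<and> invocation p t (Inr d)"
  using assms
proof (induction k)
  case 0
  then show ?case by (simp add: init initial_def)
next
  case (Suc k)
  then have "k < n" by simp
  show ?case
  proof (cases "d \<in> used (c k)")
    case True
    then show ?thesis using Suc by (meson less_SucI \<open>k < n\<close> less_imp_le)
  next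
    case False
    show ?thesis
      using step[OF \<open>k < n\<close>]
    proof cases
      case (invoke_MCAS t d')
      then have "d' = d" using False Suc.prems(2) by simp
      then show ?thesis
        using invoke_MCAS \<open>k < n\<close> Suc.prems(2) False
        by (intro exI[of _ k] exI[of _ t]) (auto simp: invocation_def op_label_def executing_def)
    qed (use False Suc.prems(2) in auto)
  qed
qed

lemma invocation_op_unique:
  assumes "invocation p t x" "invocation p t' x'"
  shows "x = x'"
  using assms by (cases x; cases x') (auto simp: invocation_def op_label_def)

lemma invocation_unique:
  assumes "invocation p t (Inr d)" "invocation p' t' (Inr d)"
  shows "p = p'"
proof -
  have "\<not> p < p'" if "invocation p t (Inr d)" "invocation p' t' (Inr d)" for p p' t t'
  proof
    assume "p < p'"
    moreover have "p' < n" "d \<in> used (c (Suc p))" "d \<notin> used (c p')"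
      using that unfolding invocation_def by blast+
    ultimately show False using used_mono[of "Suc p" p'] by auto
  qed
  then show ?thesis using assms by (meson linorder_neqE_nat)
qed

text \<open>Counterpart of \<open>completes\<close> for positions in the execution, where internal
  steps of the thread may lie in between.\<close>

definition completion :: "nat \<Rightarrow> nat \<Rightarrow> 'v result \<Rightarrow> bool" where
  "completion p q r \<longleftrightarrow> p < q \<and> q < n \<and>
     (\<exists>t x. l p = Inv t x \<and> l q = Res t r \<and>
        (\<forall>k. p < k \<and> k < q \<longrightarrow> thread_of (l k) = t \<longrightarrow> l k = Tau t))"

lemma completion_unique:
  assumes "completion p q r" "completion p q' r'"
  shows "q = q' \<and> r = r'"
proof -
  have "\<not> q < q'" if "completion p q r" "completion p q' r'" for q q' r r'
  proof
    assume "q < q'"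
    moreover obtain t x where "l p = Inv t x" "l q = Res t r" "p < q"
      using \<open>completion p q r\<close> by (auto simp: completion_def)
    ultimately have "l q = Tau t" using \<open>completion p q' r'\<close> by (auto simp: completion_def)
    then show False using \<open>l q = Res t r\<close> by simp
  qed
  then have "q = q'" using assms by (meson linorder_neqE_nat)
  then show ?thesis using assms by (auto simp: completion_def)
qed

lemma completion_result:
  assumes "invocation p t x" "completion p q r"
  shows "result_ok q t x r"
proof -
  have q: "p < q" "q < n" "l q = Res t r"
    "\<And>k. p < k \<Longrightarrow> k < q \<Longrightarrow> thread_of (l k) = t \<Longrightarrow> l k = Tau t"
    using assms by (auto simp: completion_def invocation_def)
  have "executing k t x" if "Suc p \<le> k" "k \<le> q" for k
    using that
  proof (induction k rule: dec_induct)
    case base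
    then show ?case using assms(1) by (simp add: invocation_def)
  next
    case (step m)
    then show ?case using executing_Suc[of m t x] q by auto
  qed
  then have "executing q t x" using q(1) by auto
  moreover have "control (c q) t = Done r"
    using step[OF q(2)] q(3) by cases auto
  ultimately show ?thesis by (simp add: executing_def)
qed

lemma thread_statesD:
  assumes "s \<in> thread_states q t" "control (c p) t = Idle" "p \<le> q"
  obtains j where "p < j" "j \<le> q" "s = abs_state j"
proof -
  obtain j where j: "s = abs_state j" "j \<le> q" "\<forall>i\<in>{j..q}. control (c i) t \<noteq> Idle"
    using assms(1) by (auto simp: thread_states_def)
  then have "\<not> j \<le> p" using assms(2,3) by auto
  then show ?thesis using that[of j] j by simp
qed

text \<open>Slot \<open>2 * j\<close> lies between the steps \<open>j - 1\<close> and \<open>j\<close>; slot \<open>2 * j + 1\<close> is step \<open>j\<close>.\<close>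

definition slot_state :: "nat \<Rightarrow> 'a \<Rightarrow> 'v" where
  "slot_state s = abs_state (s div 2)"

text \<open>The states at times 0 to \<open>n\<close> and the \<open>n\<close> steps between them
  give \<open>2 * n + 1\<close> slots. Invocation step \<open>p\<close> ends at time
  \<open>p + 1\<close>, hence \<open>p < s div 2\<close>. The last two conditions reserve odd slots
  for successful MCAS operations, each at the step that decides its descriptor.\<close>

definition linearized :: "nat \<Rightarrow> 'a + 'd \<Rightarrow> nat \<Rightarrow> 'v result \<Rightarrow> bool" where
  "linearized p x s r \<longleftrightarrow> s < 2 * n + 1 \<and> p < s div 2 \<and>
     (\<forall>q r'. completion p q r' \<longrightarrow> s div 2 \<le> q \<and> r' = r) \<and>
     mcas_spec (slot_state s) (op_label D x) = (slot_state (Suc s), r) \<and>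
     (odd s \<longrightarrow> (\<exists>d. x = Inr d \<and> stat (s div 2) d = ACTIVE \<and> stat (Suc (s div 2)) d = SUCCESSFUL)) \<and>
     (\<forall>d. x = Inr d \<and> stat n d = SUCCESSFUL \<longrightarrow> odd s)"

text \<open>A pending MCAS with decided status is included because other operations may already have
  observed its effect.\<close>

definition effective :: "nat \<Rightarrow> 'a + 'd \<Rightarrow> bool" where
  "effective p x \<longleftrightarrow> (case x of Inl a \<Rightarrow> \<exists>q r. completion p q r | Inr d \<Rightarrow> stat n d \<noteq> ACTIVE)"

lemma completion_effective:
  assumes "invocation p t x" "completion p q r"
  shows "effective p x"
proof (cases x)
  case (Inr d)
  then have q: "q \<le> n" "stat q d \<noteq> ACTIVE"
    using completion_result[OF assms] assms(2) by (auto simp: result_ok_def completion_def)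
  then have "stat n d \<noteq> ACTIVE" using stat_persistent[of q n d] by simp
  then show ?thesis using Inr by (simp add: effective_def)
qed (use assms in \<open>auto simp: effective_def\<close>)

lemma effective_linearized:
  assumes "invocation p t x" "effective p x"
  shows "\<exists>s r. linearized p x s r"
proof (cases x)
  case (Inl a)
  then obtain q r where q: "completion p q r" using assms(2) by (auto simp: effective_def)
  then have "p < q" "q < n" by (auto simp: completion_def)
  obtain s where s: "s \<in> thread_states q t" "r = Value (s a)"
    using completion_result[OF assms(1) q] Inl by (auto simp: result_ok_def)
  obtain j where "p < j" "j \<le> q" "s = abs_state j"
    using thread_statesD[OF s(1), of p] assms(1) \<open>p < q\<close> by (auto simp: invocation_def)
  then have "linearized p x (2 * j) r"
    using Inl \<open>q < n\<close> s(2) completion_unique[OF q]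
    by (auto simp: linearized_def slot_state_def op_label_def)
  then show ?thesis by blast
next
  case (Inr d)
  then have "stat n d \<noteq> ACTIVE" using assms(2) by (simp add: effective_def)
  then obtain j where j: "j < n" "stat j d = ACTIVE" "stat (Suc j) d \<noteq> ACTIVE"
    "\<forall>i. Suc j \<le> i \<longrightarrow> i \<le> n \<longrightarrow> stat i d = stat (Suc j) d"
    "\<forall>i. stat i d \<noteq> ACTIVE \<longrightarrow> Suc j \<le> i"
    by (rule status_decided[OF order_refl])
  have complete: "Suc j \<le> q \<and> r = Flag (stat (Suc j) d = SUCCESSFUL)" if "completion p q r" for q r
  proof -
    have "q < n" "stat q d \<noteq> ACTIVE" "r = Flag (stat q d = SUCCESSFUL)"
      using that completion_result[OF assms(1) that] Inr by (auto simp: result_ok_def completion_def)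
    moreover from this have "Suc j \<le> q" using j(5) by blast
    moreover from this have "stat q d = stat (Suc j) d" using j(4) \<open>q < n\<close> less_imp_le by blast
    ultimately show ?thesis by simp
  qed
  have after: "p < i" if "d \<in> used (c i)" "i \<le> n" for i
    using that used_mono[of i p] assms(1) Inr by (fastforce simp: invocation_def)
  have final: "stat n d = stat (Suc j) d" using j(1,4) Suc_leI by blast
  show ?thesis
  proof (cases "stat (Suc j) d")
    case SUCCESSFUL
    note success = successful_step(1,2)[OF j(1,2) SUCCESSFUL]
    have "\<forall>q r'. completion p q r' \<longrightarrow> j \<le> q \<and> r' = Flag True" using complete SUCCESSFUL by fastforce
    moreover have "p < j" using after success(1) j(1) by simp
    ultimately have "linearized p x (2 * j + 1) (Flag True)"
      unfolding linearized_def slot_state_def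
      using success(2) j(1,2) SUCCESSFUL Inr by (simp add: op_label_def del: mcas_spec.simps)
    then show ?thesis by blast
  next
    case FAILED
    have "shared_inv (Suc j)" using inv[of "Suc j"] j(1) by (simp add: inv_def)
    then have "mismatch (Suc j) d" using FAILED by (simp add: shared_inv_def)
    \<comment> \<open>The mismatch was observed no later than the decision, which precedes any
      response, and after the invocation, since \<open>d\<close> was already used.\<close>
    then obtain i where i: "i \<le> Suc j" "d \<in> used (c i)"
      "mcas_spec (abs_state i) (MCAS_Op (tuples D d)) = (abs_state i, Flag False)"
      by (rule mismatch_spec)
    have "\<forall>q r'. completion p q r' \<longrightarrow> i \<le> q \<and> r' = Flag False" using complete FAILED i(1) by fastforce
    moreover have "p < i" using after i j(1) by simp
    ultimately have "linearized p x (2 * i) (Flag False)"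
      unfolding linearized_def slot_state_def
      using i j(1) FAILED Inr final by (simp add: op_label_def del: mcas_spec.simps)
    then show ?thesis by blast
  qed (use j(3) in simp)
qed

lemma slot_change:
  assumes "s < 2 * n + 1" "slot_state (Suc s) \<noteq> slot_state s"
  obtains d p t where "odd s" "s div 2 < n" "stat (s div 2) d = ACTIVE"
    "stat (Suc (s div 2)) d = SUCCESSFUL" "invocation p t (Inr d)"
proof -
  have "odd s" using assms(2) by (auto simp: slot_state_def elim!: evenE)
  then have s: "odd s" "Suc s div 2 = Suc (s div 2)" by (auto elim: oddE)
  then have n: "s div 2 < n" using assms(1) by (auto elim: oddE)
  obtain d where d: "stat (s div 2) d = ACTIVE" "stat (Suc (s div 2)) d = SUCCESSFUL"
    using abs_state_Suc[OF n] assms(2) s(2) by (auto simp: slot_state_def)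
  then show ?thesis
    using that[OF s(1) n d] used_invoked[OF less_imp_le[OF n] successful_step(1)[OF n d]] by blast
qed

end

section \<open>From slots to a linearization\<close>

lemma legal_slots:
  fixes B :: "nat \<Rightarrow> 's" and slot :: "'i \<Rightarrow> nat"
  assumes "sorted (map slot xs)" "distinct xs"
    and "\<And>x. x \<in> set xs \<Longrightarrow> b \<le> slot x \<and> slot x < T"
    and "\<And>x. x \<in> set xs \<Longrightarrow> spec (B (slot x)) (f x) = (B (Suc (slot x)), g x)"
    and "\<And>s. b \<le> s \<Longrightarrow> s < T \<Longrightarrow> B (Suc s) \<noteq> B s \<Longrightarrow> \<exists>x \<in> set xs. slot x = s"
    and "\<And>x y. x \<in> set xs \<Longrightarrow> y \<in> set xs \<Longrightarrow> slot x = slot y \<Longrightarrow> B (Suc (slot x)) \<noteq> B (slot x) \<Longrightarrow> x = y"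
  shows "legal spec (B b) (map (\<lambda>x. (f x, g x)) xs)"
  using assms
proof (induction xs arbitrary: b)
  case (Cons x xs)
  have bounds: "b \<le> slot x" "slot x < T" using Cons.prems(3) by auto
  have "B s = B b" if "b \<le> s" "s \<le> slot x" for s
    using that
  proof (induction s rule: dec_induct)
    case (step s)
    have "B (Suc s) = B s"
    proof (rule ccontr)
      assume "B (Suc s) \<noteq> B s"
      then obtain y where "y \<in> set (x # xs)" "slot y = s"
        using Cons.prems(5)[of s] step.hyps step.prems bounds by auto
      then show False using Cons.prems(1) step.prems by auto
    qed
    then show ?case using step by simp
  qed simp
  from this[OF bounds(1) order_refl] have Bb: "B b = B (slot x)" ..
  have "legal spec (B (Suc (slot x))) (map (\<lambda>x. (f x, g x)) xs)"
  \<comment> \<open>A slot that keeps the state may be shared, so the induction resumes at the same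
    slot. A slot that changes it belongs to \<open>x\<close> alone, so the induction resumes at the
    next one.\<close>
  proof (cases "B (Suc (slot x)) = B (slot x)")
    case True
    have "legal spec (B (slot x)) (map (\<lambda>x. (f x, g x)) xs)"
    proof (rule Cons.IH)
      fix s
      assume s: "slot x \<le> s" "s < T" "B (Suc s) \<noteq> B s"
      then obtain y where "y \<in> set (x # xs)" "slot y = s" using Cons.prems(5)[of s] bounds by auto
      then show "\<exists>y \<in> set xs. slot y = s" using s(3) True by auto
    next
      fix y
      assume "y \<in> set xs"
      then show "slot x \<le> slot y \<and> slot y < T" using Cons.prems(1,3) by simp
    next
      fix y z
      assume "y \<in> set xs" "z \<in> set xs" "slot y = slot z" "B (Suc (slot y)) \<noteq> B (slot y)"
      then show "y = z" using Cons.prems(6)[of y z] by simp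
    qed (use Cons.prems(1,2,4) in simp_all)
    then show ?thesis using True by simp
  next
    case False
    show ?thesis
    proof (rule Cons.IH)
      fix s
      assume s: "Suc (slot x) \<le> s" "s < T" "B (Suc s) \<noteq> B s"
      then obtain y where "y \<in> set (x # xs)" "slot y = s" using Cons.prems(5)[of s] bounds by auto
      then show "\<exists>y \<in> set xs. slot y = s" using s(1) by auto
    next
      fix y
      assume y: "y \<in> set xs"
      then have "x \<noteq> y" using Cons.prems(2) by auto
      then have "slot y \<noteq> slot x" using Cons.prems(6)[of x y] y False by auto
      moreover have "slot x \<le> slot y" using y Cons.prems(1) by simp
      ultimately show "Suc (slot x) \<le> slot y \<and> slot y < T" using y Cons.prems(3)[of y] by simp
    next
      fix y z
      assume "y \<in> set xs" "z \<in> set xs" "slot y = slot z" "B (Suc (slot y)) \<noteq> B (slot y)"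
      then show "y = z" using Cons.prems(6)[of y z] by simp
    qed (use Cons.prems(1,2,4) in simp_all)
  qed
  then show ?case using Cons.prems(4)[of x] by (simp add: Bb)
qed simp

text \<open>The point of an operation \<open>i\<close> lies between the events \<open>g (slot i) - 1\<close> and \<open>g (slot i)\<close>; within
  such an interval the points are ordered by slot and, within a slot, by identifier.\<close>

lemma linearizable_history_slots:
  fixes B :: "nat \<Rightarrow> 's" and g :: "nat \<Rightarrow> nat"
  assumes "B 0 = s0" "mono g"
    and invokes: "\<And>i. i \<in> S \<Longrightarrow> invokes h i (f i)"
    and completes: "\<And>i j r. completes h i j r \<Longrightarrow> i \<in> S \<and> res i = r \<and> g (slot i) \<le> j"
    and after: "\<And>i. i \<in> S \<Longrightarrow> i < g (slot i)"
    and bound: "\<And>i. i \<in> S \<Longrightarrow> slot i < T"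
    and spec: "\<And>i. i \<in> S \<Longrightarrow> spec (B (slot i)) (f i) = (B (Suc (slot i)), res i)"
    and change: "\<And>s. s < T \<Longrightarrow> B (Suc s) \<noteq> B s \<Longrightarrow> \<exists>i \<in> S. slot i = s"
    and unique: "\<And>i j. i \<in> S \<Longrightarrow> j \<in> S \<Longrightarrow> slot i = slot j \<Longrightarrow> B (Suc (slot i)) \<noteq> B (slot i) \<Longrightarrow> i = j"
  shows "linearizable_history spec s0 h"
proof -
  \<comment> \<open>A base above every identifier makes \<open>key\<close> injective on
    \<open>S\<close> and lexicographic in slot and identifier.\<close>
  define M where "M = Suc (length h)"
  define key where "key i = slot i * M + i" for i
  define xs where "xs = sort_key key (sorted_list_of_set S)"
  \<comment> \<open>The offset decreases with the key, so points increase with it. The summand 2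
    keeps the offset below 1 even for key 0, so a point stays strictly after the invocation
    event.\<close>
  define pt where "pt i = real (g (slot i)) - 1 / (real (key i) + 2)" for i
  define L where "L = map (\<lambda>i. (i, f i, res i)) xs"
  have less_M: "i < M" if "i \<in> S" for i using invokes[OF that] by (simp add: invokes_def M_def)
  then have "finite S" by (meson finite_lessThan finite_subset lessThan_iff subsetI)
  then have xs: "set xs = S" "distinct xs" by (simp_all add: xs_def)
  have slot: "key i div M = slot i" and mod: "key i mod M = i" if "i \<in> S" for i
    using less_M[OF that] by (simp_all add: key_def)
  have slot_mono: "slot i \<le> slot j" if "i \<in> S" "j \<in> S" "key i \<le> key j" for i j
    using div_le_mono[OF that(3), of M] slot[OF that(1)] slot[OF that(2)] by simp
  have "inj_on key S" using mod by (metis inj_onI)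
  then have "distinct (map key xs)" using xs by (simp add: distinct_map)
  then have sorted: "sorted_wrt (\<lambda>i j. key i < key j) xs"
    using strict_sorted_iff[of "map key xs"] sorted_sort_key[of key "sorted_list_of_set S"]
    by (simp add: xs_def sorted_wrt_map)
  have pt_mono: "pt i < pt j" if "i \<in> S" "j \<in> S" "key i < key j" for i j
  proof -
    have "g (slot i) \<le> g (slot j)"
      using that slot_mono[of i j] \<open>mono g\<close> by (simp add: monoD)
    moreover have "1 / (real (key j) + 2) < 1 / (real (key i) + 2)"
      using that(3) by (intro divide_strict_left_mono) auto
    ultimately show ?thesis by (simp add: pt_def)
  qed
  have pt_less: "pt i < real (g (slot i))" for i by (simp add: pt_def)
  have less_pt: "real i < pt i" if "i \<in> S" for i
  proof -
    have "1 / (real (key i) + 2) < 1" by simp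
    moreover have "real i + 1 \<le> real (g (slot i))" using after[OF that] by simp
    ultimately show ?thesis unfolding pt_def by linarith
  qed
  have "distinct (map fst L)" using xs by (simp add: L_def comp_def)
  moreover have "\<forall>(i, x, r) \<in> set L. invokes h i x" using invokes xs by (auto simp: L_def)
  moreover have "\<forall>i j r. completes h i j r \<longrightarrow> (\<exists>x. (i, x, r) \<in> set L)"
    using completes unfolding L_def set_map xs(1) by blast
  moreover have "\<forall>(i, x, r) \<in> set L. real i < pt i \<and> (\<forall>j r'. completes h i j r' \<longrightarrow> pt i < real j)"
  proof -
    have "pt i < real j" if "completes h i j r" for i j r
      using pt_less[of i] completes[OF that] by linarith
    then show ?thesis using less_pt xs by (auto simp: L_def)
  qed
  moreover have "sorted_wrt (<) (map (pt \<circ> fst) L)"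
    using sorted_wrt_mono_rel[OF _ sorted, of "\<lambda>i j. pt i < pt j"] pt_mono xs
    by (simp add: L_def sorted_wrt_map comp_def)
  moreover have "legal spec s0 (map snd L)"
  proof -
    have "sorted_wrt (\<lambda>i j. slot i \<le> slot j) xs"
      using sorted_wrt_mono_rel[OF _ sorted, of "\<lambda>i j. slot i \<le> slot j"] slot_mono xs by simp
    then have "sorted (map slot xs)" by (simp add: sorted_wrt_map)
    from legal_slots[OF this xs(2), of 0 T spec B f res]
    have "legal spec (B 0) (map (\<lambda>i. (f i, res i)) xs)"
      using bound spec change unique unfolding xs(1) by blast
    then show ?thesis by (simp add: L_def comp_def \<open>B 0 = s0\<close>)
  qed
  ultimately show ?thesis unfolding linearizable_history_def by blast
qed

section \<open>Steps of an execution and events of its history\<close>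

definition events :: "('t, 'o, 'r) label list \<Rightarrow> nat list" where
  "events ls = filter (\<lambda>k. is_inv (ls ! k) \<or> is_res (ls ! k)) [0..<length ls]"

lemma history_events: "history ls = map ((!) ls) (events ls)"
  unfolding history_def events_def
  by (subst map_nth[of ls, symmetric], subst filter_map) (simp add: comp_def)

lemma sorted_events: "sorted_wrt (<) (events ls)"
  by (simp add: events_def sorted_wrt_filter)

text \<open>This is also the history index of the first event at position \<open>j\<close> or later,
  if there is one; it turns times of the execution into times of the history.\<close>

definition event_count :: "('t, 'o, 'r) label list \<Rightarrow> nat \<Rightarrow> nat" where
  "event_count ls j = card {p \<in> set (events ls). p < j}"

lemma mono_event_count: "mono (event_count ls)"
  by (auto simp: event_count_def intro!: monoI card_mono)

lemma less_event_count:
  assumes "i < length (events ls)" "events ls ! i < j"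
  shows "i < event_count ls j"
proof -
  have "(!) (events ls) ` {..i} \<subseteq> {p \<in> set (events ls). p < j}"
  proof
    fix p
    assume "p \<in> (!) (events ls) ` {..i}"
    then obtain m where m: "p = events ls ! m" "m \<le> i" by auto
    then have "events ls ! m \<le> events ls ! i"
      using sorted_wrt_nth_less[OF sorted_events[of ls], of m i] assms(1) by (cases "m = i") auto
    then show "p \<in> {p \<in> set (events ls). p < j}" using m assms by auto
  qed
  moreover have "inj_on ((!) (events ls)) {..i}"
    using assms(1) sorted_events by (intro inj_on_nth) (auto simp: strict_sorted_iff)
  ultimately have "card {..i} \<le> event_count ls j"
    unfolding event_count_def by (intro card_inj_on_le[of "(!) (events ls)"]) auto
  then show ?thesis by simp
qed

lemma event_count_le:
  assumes "i < length (events ls)" "j \<le> events ls ! i"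
  shows "event_count ls j \<le> i"
proof -
  have "{p \<in> set (events ls). p < j} \<subseteq> (!) (events ls) ` {..<i}"
  proof
    fix p
    assume "p \<in> {p \<in> set (events ls). p < j}"
    then obtain m where m: "p = events ls ! m" "m < length (events ls)" "p < j"
      by (auto simp: in_set_conv_nth)
    have "m < i"
    proof (rule ccontr)
      assume "\<not> m < i"
      then have "events ls ! i \<le> events ls ! m"
        using sorted_wrt_nth_less[OF sorted_events[of ls], of i m] m(2) by (cases "m = i") auto
      then show False using m assms by simp
    qed
    then show "p \<in> (!) (events ls) ` {..<i}" using m by auto
  qed
  then have "event_count ls j \<le> card ((!) (events ls) ` {..<i})"
    unfolding event_count_def by (rule card_mono[rotated]) simp
  also have "\<dots> \<le> i" using card_image_le[of "{..<i}"] by simp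
  finally show ?thesis .
qed

lemma run_execution:
  assumes "run stp c0 ls cf"
  shows "\<exists>c. c 0 = c0 \<and> (\<forall>k < length ls. stp (c k) (ls ! k) (c (Suc k)))"
proof -
  have "\<exists>c. c 0 = c0 \<and> c (length ls) = cf \<and> (\<forall>k < length ls. stp (c k) (ls ! k) (c (Suc k)))"
    using assms
  proof induction
    case (run_snoc ls cf y cf')
    then obtain c where "c 0 = c0" "c (length ls) = cf"
      "\<forall>k < length ls. stp (c k) (ls ! k) (c (Suc k))" by blast
    then show ?case
      using run_snoc.hyps
      by (intro exI[of _ "c(Suc (length ls) := cf')"]) (auto simp: nth_append less_Suc_eq)
  qed auto
  then show ?thesis by blast
qed

lemma (in execution) linearizable_history:
  assumes ls: "n = length ls" "l = (!) ls"
  shows "linearizable_history mcas_spec s0 (history ls)"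
proof -
  define h where "h = history ls"
  define pos where "pos i = events ls ! i" for i
  have len: "length h = length (events ls)" by (simp add: h_def history_events)
  have h_nth: "h ! i = l (pos i)" if "i < length h" for i
    using that by (simp add: h_def history_events pos_def ls)
  have pos_less: "pos i < n" if "i < length h" for i
  proof -
    have "pos i \<in> set (events ls)" using that by (simp add: pos_def len)
    then show ?thesis by (auto simp: events_def ls(1))
  qed
  have pos_mono: "pos i < pos j \<longleftrightarrow> i < j" if "i < length h" "j < length h" for i j
  proof -
    have "pos i < pos j" if "i < j" "j < length h" for i j
      using sorted_wrt_nth_less[OF sorted_events[of ls], of i j] that unfolding pos_def len by simp
    then show ?thesis using that by (metis linorder_neqE_nat order_less_asym)
  qed
  have pos_exists: "\<exists>i < length h. pos i = p" if "p < n" "is_inv (l p) \<or> is_res (l p)" for p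
  proof -
    have "p \<in> set (events ls)" using that by (simp add: events_def ls)
    then show ?thesis by (metis in_set_conv_nth len pos_def)
  qed
  have completion: "completion (pos i) (pos j) r" if compl: "completes h i j r" for i j r
  proof -
    obtain t x where *: "i < j" "j < length h" "h ! i = Inv t x" "h ! j = Res t r"
      "\<And>k. i < k \<Longrightarrow> k < j \<Longrightarrow> thread_of (h ! k) \<noteq> t"
      using compl unfolding completes_def by blast
    have "l p = Tau t" if p: "pos i < p" "p < pos j" "thread_of (l p) = t" for p
    proof (rule ccontr)
      assume "l p \<noteq> Tau t"
      then have "is_inv (l p) \<or> is_res (l p)"
        using p(3) by (cases "l p") (auto simp: is_inv_def is_res_def)
      then obtain k where k: "k < length h" "pos k = p"
        using pos_exists[of p] p(2) pos_less[OF *(2)] by auto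
      then have "i < k" "k < j" using p * pos_mono by auto
      then show False using * k h_nth p(3) by metis
    qed
    moreover have "pos i < pos j" using * pos_mono[of i j] by simp
    moreover have "l (pos i) = Inv t x" "l (pos j) = Res t r" using * h_nth[of i] h_nth[of j] by simp_all
    ultimately show ?thesis using pos_less[OF *(2)] unfolding completion_def by blast
  qed
  \<comment> \<open>Unspecified where no invocation takes place; elsewhere uniqueness makes the
    choice canonical.\<close>
  define X where "X p = (SOME x. \<exists>t. invocation p t x)" for p
  have X: "x = X p" if "invocation p t x" for p t x
    using someI[of "\<lambda>x. \<exists>t. invocation p t x" x] that invocation_op_unique unfolding X_def by blast
  define S where "S = {i. i < length h \<and> (\<exists>t. invocation (pos i) t (X (pos i))) \<and> effective (pos i) (X (pos i))}"
  have "\<exists>s r. linearized (pos i) (X (pos i)) s r" if "i \<in> S" for i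
    using that effective_linearized by (auto simp: S_def)
  then obtain slot res where lin: "\<And>i. i \<in> S \<Longrightarrow> linearized (pos i) (X (pos i)) (slot i) (res i)"
    by metis
  have in_S: "i \<in> S" if "i < length h" "invocation (pos i) t x" "effective (pos i) x" for i t x
    using that X by (auto simp: S_def)
  have invoked: "\<exists>t x. invocation (pos i) t x" if "i < length h" "h ! i = Inv t y" for i t y
    using that invocation_exists pos_less h_nth by metis
  have "linearizable_history mcas_spec s0 h"
  proof (rule linearizable_history_slots[where B = slot_state and g = "\<lambda>s. event_count ls (s div 2)"
        and S = S and slot = slot and res = res and f = "\<lambda>i. op_label D (X (pos i))" and T = "2 * n + 1"])
    show "slot_state 0 = s0"
      by (simp add: slot_state_def abs_state_def val_def mem_def init initial_def fun_eq_iff)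
    show "mono (\<lambda>s. event_count ls (s div 2))"
      by (intro monoI monoD[OF mono_event_count] div_le_mono)
  next
    fix i
    assume i: "i \<in> S"
    then show "invokes h i (op_label D (X (pos i)))"
      using h_nth by (auto simp: S_def invokes_def invocation_def)
    show "slot i < 2 * n + 1"
      "mcas_spec (slot_state (slot i)) (op_label D (X (pos i))) = (slot_state (Suc (slot i)), res i)"
      using lin[OF i] by (simp_all only: linearized_def)
    show "i < event_count ls (slot i div 2)"
      using lin[OF i] i len unfolding linearized_def
      by (intro less_event_count) (simp_all add: S_def pos_def)
  next
    fix i j r
    assume compl: "completes h i j r"
    then obtain t x where i: "i < length h" "j < length h" "h ! i = Inv t x" by (auto simp: completes_def)
    then obtain t x where inv: "invocation (pos i) t x" using invoked by blast
    then have "i \<in> S" using in_S i completion_effective completion[OF compl] by blast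
    moreover from lin[OF this] have "slot i div 2 \<le> pos j" "res i = r"
      using completion[OF compl] unfolding linearized_def by blast+
    ultimately show "i \<in> S \<and> res i = r \<and> event_count ls (slot i div 2) \<le> j"
      using i len by (auto simp: pos_def intro: event_count_le)
  next
    fix s
    assume s: "s < 2 * n + 1" "slot_state (Suc s) \<noteq> slot_state s"
    then obtain d p t where d: "odd s" "s div 2 < n" "stat (s div 2) d = ACTIVE"
      "stat (Suc (s div 2)) d = SUCCESSFUL" "invocation p t (Inr d)"
      by (rule slot_change)
    obtain i where i: "i < length h" "pos i = p"
      using pos_exists[of p] d(5) by (auto simp: invocation_def is_inv_def)
    have X_p: "X p = Inr d" using X[OF d(5)] by simp
    have "stat n d = SUCCESSFUL" using stat_persistent[of "Suc (s div 2)" n d] d(2,4) by simp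
    then have "i \<in> S" using in_S[of i] i d(5) by (simp add: effective_def)
    \<comment> \<open>The slot of this operation is a step that decides \<open>d\<close>. A status
      is decided only once, so the slot is \<open>s\<close>.\<close>
    from lin[OF this] have slot_i: "odd (slot i)" "slot i div 2 < n" "stat (slot i div 2) d = ACTIVE"
      "stat (Suc (slot i div 2)) d = SUCCESSFUL"
      using \<open>stat n d = SUCCESSFUL\<close> i(2) X_p unfolding linearized_def by (force elim: oddE)+
    then have "slot i div 2 = s div 2" using d status_step_unique[of "slot i div 2" d "s div 2"] by simp
    then have "slot i = s" using d(1) slot_i(1) by (metis odd_two_times_div_two_succ)
    then show "\<exists>i \<in> S. slot i = s" using \<open>i \<in> S\<close> by blast
  next
    fix i j
    assume ij: "i \<in> S" "j \<in> S" "slot i = slot j" "slot_state (Suc (slot i)) \<noteq> slot_state (slot i)"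
    obtain d where d: "odd (slot i)" "slot i div 2 < n"
      using slot_change[OF _ ij(4)] lin[OF ij(1)] unfolding linearized_def by blast
    then obtain di dj where
      di: "X (pos i) = Inr di" "stat (slot i div 2) di = ACTIVE" "stat (Suc (slot i div 2)) di = SUCCESSFUL" and
      dj: "X (pos j) = Inr dj" "stat (slot i div 2) dj = ACTIVE" "stat (Suc (slot i div 2)) dj = SUCCESSFUL"
      using lin[OF ij(1)] lin[OF ij(2)] ij(3) unfolding linearized_def by metis
    \<comment> \<open>A step decides at most one descriptor, and a descriptor has only one
      invocation.\<close>
    then have "di = dj" using successful_step(3)[OF d(2) di(2,3), of dj] by auto
    then have "pos i = pos j" using ij(1,2) di(1) dj(1) invocation_unique by (auto simp: S_def)
    then show "i = j" using ij(1,2) pos_mono[of i j] pos_mono[of j i] by (auto simp: S_def)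
  qed
  then show ?thesis by (simp add: h_def)
qed

section \<open>Lock-freedom\<close>

text \<open>While the shared memory stays as it is, a thread in control state \<open>X\<close> either completes its
  operation or eventually modifies the memory.\<close>

inductive halts :: "('a, 'v, 'w, 'd) descriptors \<Rightarrow> ('a, 'v, 'w, 'd) shared
    \<Rightarrow> ('a, 'v, 'w, 'd) control \<Rightarrow> bool"
  for D :: "('a, 'v, 'w, 'd) descriptors" and sh :: "('a, 'v, 'w, 'd) shared" where
  halts_Done: "halts D sh (Done r)"
| halts_change: "fst (exec D sh X) \<noteq> sh \<Longrightarrow> halts D sh X"
| halts_step: "fst (exec D sh X) = sh \<Longrightarrow> halts D sh (snd (exec D sh X)) \<Longrightarrow> halts D sh X"

lemma fun_upd_neq: "f a \<noteq> b \<Longrightarrow> f(a := b) \<noteq> f"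
  by (metis fun_upd_same)

section \<open>Halting of single lines in a frozen memory\<close>

context
  fixes D :: "('a :: linorder, 'v, 'w, 'd) descriptors" and m :: "'a \<Rightarrow> ('v, 'w) content"
    and st :: "'d \<Rightarrow> status"
begin

abbreviation hlt :: "('a, 'v, 'w, 'd) control \<Rightarrow> bool" where
  "hlt \<equiv> halts D (m, st)"

lemma halts_M7: "\<forall>b. hlt (return_MCAS b mc) \<Longrightarrow> hlt (M7 d mc)"
  by (subst halts.simps) auto

text \<open>With an ACTIVE status the CAS itself modifies the memory, whatever the caller would do
  next. Hence the disjunction that recurs in the following lemmas.\<close>

lemma halts_M6:
  assumes "st d = ACTIVE \<or> (\<forall>b. hlt (return_MCAS b mc))"
  shows "hlt (M6 d b mc)"
proof (cases "st d = ACTIVE")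
  case True
  then show ?thesis by (subst halts.simps) (simp add: fun_upd_neq)
next
  case False
  then show ?thesis using assms by (subst halts.simps) (simp add: halts_M7)
qed

lemma halts_M5:
  assumes "hlt (Loop d (w # ws) mc)" "x \<noteq> Ptr w"
  shows "hlt (M5 d w ws x mc)"
proof (cases "m (address D w) = x")
  case True
  then show ?thesis using assms(2) by (subst halts.simps) (simp add: fun_upd_neq)
next
  case False
  then show ?thesis using assms(1) by (subst halts.simps) simp
qed

lemma halts_M5_current:
  assumes "m (address D w) \<noteq> Ptr w"
  shows "hlt (M5 d w ws (m (address D w)) mc)"
  using assms by (subst halts.simps) (simp add: fun_upd_neq)

lemma halts_M4:
  assumes "st d = ACTIVE \<Longrightarrow> hlt (M5 d w ws x mc)" "st d = ACTIVE \<or> (\<forall>b. hlt (return_MCAS b mc))"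
  shows "hlt (M4 d w ws x mc)"
  using assms halts_M6[of d mc] by (subst halts.simps) (cases "st d = ACTIVE"; simp)+

lemma halts_M3:
  assumes "st d = ACTIVE \<Longrightarrow> hlt (M5 d w ws x mc)" "st d = ACTIVE \<or> (\<forall>b. hlt (return_MCAS b mc))"
  shows "hlt (M3 d w ws x v mc)"
  using assms halts_M4[of d w ws x mc] halts_M6[of d mc False] by (subst halts.simps) simp

lemma halts_M2:
  assumes "x = Ptr w \<Longrightarrow> hlt (Loop d ws mc)"
    and "x \<noteq> Ptr w \<Longrightarrow> st d = ACTIVE \<Longrightarrow> hlt (M5 d w ws x mc)"
    and "st d = ACTIVE \<or> (\<forall>b. hlt (return_MCAS b mc))"
  shows "hlt (M2 d w ws x v mc)"
  using assms halts_M3[of d w ws x mc v] by (subst halts.simps) (cases "x = Ptr w"; simp)+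

lemma halts_R4: "\<forall>v. hlt (return_readInternal (Ptr w) v rc) \<Longrightarrow> hlt (R4 w rc)"
  by (subst halts.simps) simp

lemma halts_R3:
  assumes "Some (parent D w) \<noteq> self \<Longrightarrow> st (parent D w) = ACTIVE \<Longrightarrow>
      hlt (Loop (parent D w) (words D (parent D w)) (From_R3 a self rc))"
    and "Some (parent D w) = self \<or> st (parent D w) \<noteq> ACTIVE \<Longrightarrow>
      \<forall>v. hlt (return_readInternal (Ptr w) v rc)"
  shows "hlt (R3 a self w rc)"
  using assms halts_R4[of w rc]
  by (subst halts.simps) (cases "Some (parent D w) \<noteq> self \<and> st (parent D w) = ACTIVE"; simp add: Let_def)+

lemma halts_R1:
  assumes "\<And>v. m a = Plain v \<Longrightarrow> hlt (return_readInternal (Plain v) v rc)"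
    and "\<And>w. m a = Ptr w \<Longrightarrow> hlt (R3 a self w rc)"
  shows "hlt (R1 a self rc)"
  using assms by (subst halts.simps) (cases "m a"; simp)+

lemma halts_Loop_Cons:
  assumes "hlt (R1 (address D w) (Some d) (From_M1 d w ws mc))"
  shows "hlt (Loop d (w # ws) mc)"
  using assms by (subst halts.simps) simp

lemma halts_Loop_Nil:
  assumes "st d = ACTIVE \<or> (\<forall>b. hlt (return_MCAS b mc))"
  shows "hlt (Loop d [] mc)"
  using halts_M6[OF assms] by (subst halts.simps) simp

text \<open>Each of these words holds its own pointer, whose parent is \<open>self\<close>, so
  readInternal returns without helping and M2 advances.\<close>

lemma halts_Loop_installed:
  assumes "\<forall>x \<in> set pre. parent D x = d \<and> m (address D x) = Ptr x" "hlt (Loop d ws mc)"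
  shows "hlt (Loop d (pre @ ws) mc)"
  using assms
proof (induction pre)
  case (Cons w pre)
  then have w: "parent D w = d" "m (address D w) = Ptr w" and IH: "hlt (Loop d (pre @ ws) mc)" by simp_all
  have "hlt (M2 d w (pre @ ws) (Ptr w) v mc)" for v
    using IH by (subst halts.simps) simp
  then have "hlt (R3 (address D w) (Some d) w (From_M1 d w (pre @ ws) mc))"
    using w(1) by (intro halts_R3) simp_all
  then have "hlt (R1 (address D w) (Some d) (From_M1 d w (pre @ ws) mc))"
    using w(2) by (intro halts_R1) simp_all
  then show ?case by (simp add: halts_Loop_Cons)
qed simp

end

section \<open>Halting of loops and call stacks\<close>

context execution
begin

abbreviation halts_at :: "nat \<Rightarrow> ('a, 'v, 'w, 'd) control \<Rightarrow> bool" where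
  "halts_at k \<equiv> halts D (mem k, stat k)"

lemma address_less:
  assumes "words D d = pre @ w # ws" "x \<in> set ws"
  shows "address D w < address D x"
  using wf assms by (auto simp: wf_descriptors_def sorted_wrt_append dest: spec[of _ d])

text \<open>If an active descriptor is blocked at address \<open>a\<close> by another active one, the latter has
  installed all its words up to \<open>a\<close>. Hence it can only be blocked at a higher address.\<close>

lemma halts_Loop_active:
  assumes "shared_inv k" "finite {a. \<exists>w. mem k a = Ptr w}"
    and "stat k d = ACTIVE" "words D d = pre @ ws"
  shows "halts_at k (Loop d ws mc)"
  using assms(3,4)
\<comment> \<open>All pointer addresses at or above some remaining word are counted, not only those
  of the words themselves, because a blocking descriptor may have different words further
  up.\<close>
proof (induction "card {a. (\<exists>w. mem k a = Ptr w) \<and> (\<exists>x \<in> set ws. address D x \<le> a)}"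
    arbitrary: d pre ws mc rule: less_induct)
  case less
  show ?case
  proof (cases ws)
    case Nil
    then show ?thesis using less.prems(1) by (simp add: halts_Loop_Nil)
  next
    case (Cons w ws')
    define a where "a = address D w"
    have words: "words D d = pre @ w # ws'" using less.prems(2) Cons by simp
    then have w: "w \<in> set (words D d)" "parent D w = d" using parent_eq[of w d] by simp_all
    have smaller: "card {b. (\<exists>w. mem k b = Ptr w) \<and> (\<exists>x \<in> set us. address D x \<le> b)} <
        card {b. (\<exists>w. mem k b = Ptr w) \<and> (\<exists>x \<in> set ws. address D x \<le> b)}"
      if "mem k a = Ptr w'" "\<forall>x \<in> set us. a < address D x" for us w'
    proof (rule psubset_card_mono)
      show "finite {b. (\<exists>w. mem k b = Ptr w) \<and> (\<exists>x \<in> set ws. address D x \<le> b)}"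
        using assms(2) by (rule rev_finite_subset) auto
      have "{b. (\<exists>w. mem k b = Ptr w) \<and> (\<exists>x \<in> set us. address D x \<le> b)} \<subseteq>
          {b. (\<exists>w. mem k b = Ptr w) \<and> (\<exists>x \<in> set ws. address D x \<le> b)}"
        using that(2) by (force simp: Cons a_def)
      moreover have "a \<in> {b. (\<exists>w. mem k b = Ptr w) \<and> (\<exists>x \<in> set ws. address D x \<le> b)}"
        using that(1) by (auto simp: Cons a_def)
      moreover have "a \<notin> {b. (\<exists>w. mem k b = Ptr w) \<and> (\<exists>x \<in> set us. address D x \<le> b)}"
        using that(2) by auto
      ultimately show "{b. (\<exists>w. mem k b = Ptr w) \<and> (\<exists>x \<in> set us. address D x \<le> b)} \<subset>
          {b. (\<exists>w. mem k b = Ptr w) \<and> (\<exists>x \<in> set ws. address D x \<le> b)}" by blast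
    qed
    have install: "halts_at k (M2 d w ws' (mem k a) v mc)" if "mem k a \<noteq> Ptr w" for v
      using that less.prems(1) unfolding a_def by (intro halts_M2) (simp_all add: halts_M5_current)
    have "halts_at k (R3 a (Some d) w' (From_M1 d w ws' mc))" if w': "mem k a = Ptr w'" for w'
    proof (rule halts_R3)
      assume "Some (parent D w') \<noteq> Some d" and active: "stat k (parent D w') = ACTIVE"
      have seen: "Ptr w' \<in> seen k a" using mem_in_seen[of k a] w' by simp
      then obtain pre' us where us: "words D (parent D w') = pre' @ w' # us" "address D w' = a"
        "\<forall>x \<in> set (pre' @ [w']). mem k (address D x) = Ptr x"
        using assms(1) active unfolding shared_inv_def pointer_inv_def by blast
      have "\<forall>x \<in> set us. a < address D x" using address_less[OF us(1)] us(2) by blast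
      moreover have "words D (parent D w') = (pre' @ [w']) @ us" using us(1) by simp
      \<comment> \<open>The hypothesis holds for an arbitrary caller: an active descriptor modifies
        the memory at M6 at the latest, so its call does not return while the memory is
        frozen.\<close>
      ultimately have "halts_at k (Loop (parent D w') us (From_R3 a (Some d) (From_M1 d w ws' mc)))"
        using less.hyps[OF smaller[OF w'] active] by blast
      moreover have "\<forall>x \<in> set (pre' @ [w']). parent D x = parent D w' \<and> mem k (address D x) = Ptr x"
        using us(1,3) parent_eq[of _ "parent D w'"]
        by (metis Un_iff \<open>words D (parent D w') = (pre' @ [w']) @ us\<close> set_append)
      ultimately show "halts_at k (Loop (parent D w') (words D (parent D w'))
          (From_R3 a (Some d) (From_M1 d w ws' mc)))"
        using halts_Loop_installed[of "pre' @ [w']" D "parent D w'" "mem k"]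
          \<open>words D (parent D w') = (pre' @ [w']) @ us\<close> by metis
    next
      assume *: "Some (parent D w') = Some d \<or> stat k (parent D w') \<noteq> ACTIVE"
      show "\<forall>v. halts_at k (return_readInternal (Ptr w') v (From_M1 d w ws' mc))"
      proof (cases "w' = w")
        case True
        have "\<forall>x \<in> set ws'. a < address D x" using address_less[OF words] unfolding a_def by blast
        moreover have "words D d = (pre @ [w]) @ ws'" using words by simp
        ultimately have "halts_at k (Loop d ws' mc)"
          using less.hyps[OF smaller[OF w'] less.prems(1)] by blast
        then show ?thesis using True less.prems(1) by (auto intro: halts_M2)
      next
        case False
        then show ?thesis using install w' by simp
      qed
    qed
    then have "halts_at k (R1 a (Some d) (From_M1 d w ws' mc))"
      using install by (intro halts_R1) auto
    then show ?thesis by (simp add: Cons a_def halts_Loop_Cons)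
  qed
qed

context
  fixes k
  assumes sh: "shared_inv k" and fin: "finite {a. \<exists>w. mem k a = Ptr w}"
begin

lemma halts_help: "stat k d = ACTIVE \<Longrightarrow> halts_at k (Loop d (words D d) mc)"
  using halts_Loop_active[OF sh fin, of d "[]"] by simp

lemma halts_R3_return:
  assumes "\<forall>v. halts_at k (return_readInternal (Ptr w) v rc)"
  shows "halts_at k (R3 a self w rc)"
  using assms by (intro halts_R3 halts_help)

lemma halts_R1_return:
  assumes "\<forall>x v. halts_at k (return_readInternal x v rc)"
  shows "halts_at k (R1 a self rc)"
  using assms by (intro halts_R1 halts_R3_return) auto

text \<open>Helping an active descriptor ends in a modification. Otherwise M2 either advances or
  leads through M3 or M4 out of the loop, never to M5, so induction on the remaining words
  suffices.\<close>

lemma halts_Loop_decided: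
  assumes "stat k d \<noteq> ACTIVE" "\<forall>b. halts_at k (return_MCAS b mc)"
  shows "halts_at k (Loop d ws mc)"
proof (induction ws)
  case Nil
  then show ?case using assms(2) by (simp add: halts_Loop_Nil)
next
  case (Cons w ws)
  have "\<forall>x v. halts_at k (return_readInternal x v (From_M1 d w ws mc))"
    using Cons assms by (auto intro: halts_M2)
  then show ?case by (intro halts_Loop_Cons halts_R1_return)
qed

lemma halts_Loop:
  assumes "in_loop k d ws" "\<forall>b. halts_at k (return_MCAS b mc)"
  shows "halts_at k (Loop d ws mc)"
proof (cases "stat k d = ACTIVE")
  case True
  then show ?thesis using assms(1) halts_Loop_active[OF sh fin True] by (auto simp: in_loop_def)
qed (use halts_Loop_decided assms in blast)

lemma halts_M2_return:
  assumes "in_loop k d (w # ws)" "\<forall>b. halts_at k (return_MCAS b mc)"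
  shows "x \<noteq> Ptr w \<Longrightarrow> halts_at k (M5 d w ws x mc)" "halts_at k (M2 d w ws x v mc)"
proof -
  obtain pre where "words D d = (pre @ [w]) @ ws" using assms(1) by (auto simp: in_loop_def)
  then have "halts_at k (Loop d ws mc)"
    using halts_Loop_active[OF sh fin] halts_Loop_decided assms(2) by blast
  then show "x \<noteq> Ptr w \<Longrightarrow> halts_at k (M5 d w ws x mc)" "halts_at k (M2 d w ws x v mc)"
    using halts_Loop[OF assms] assms(2) by (auto intro: halts_M2 halts_M5)
qed

lemma halts_frames:
  "read_frames k rc \<Longrightarrow> \<forall>x v. halts_at k (return_readInternal x v rc)"
  "mcas_frames k mc \<Longrightarrow> \<forall>b. halts_at k (return_MCAS b mc)"
  by (induction rc and mc) (auto intro: halts_Done halts_M2_return halts_R1_return)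

lemma control_halts:
  assumes "control_inv k t X" "X \<noteq> Idle"
  shows "halts_at k X"
proof (cases X)
  case (M3 d w ws x v mc)
  show ?thesis
    unfolding M3 using assms(1) M3 halts_M2_return(1)[of d w ws mc] halts_frames
    by (intro halts_M3) auto
next
  case (M4 d w ws x mc)
  show ?thesis
    unfolding M4 using assms(1) M4 halts_M2_return(1)[of d w ws mc] halts_frames
    by (intro halts_M4) auto
next
  case (R4 w rc)
  show ?thesis
    unfolding R4 using assms(1) R4 halts_frames(1)[of rc] by (intro halts_R4) auto
next
  case (M6 d b mc)
  show ?thesis
    unfolding M6 using assms(1) M6 halts_frames(2)[of mc] by (intro halts_M6) auto
next
  case (M7 d mc)
  show ?thesis
    unfolding M7 using assms(1) M7 halts_frames(2)[of mc] by (intro halts_M7) auto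
qed (use assms halts_frames halts_R1_return halts_R3_return halts_Loop halts_M2_return halts_Done
      in auto)

end

section \<open>Bounds on pointers and modifications\<close>

lemma non_idle_Suc:
  assumes "k < n" "control (c k) t \<noteq> Idle" "\<nexists>r. l k = Res t r"
  shows "control (c (Suc k)) t \<noteq> Idle"
  using step[OF assms(1)]
proof cases
  case (internal t' sh X)
  then have "X \<noteq> Idle" using exec_not_Idle[of "control (c k) t'" D "shared (c k)"] by simp
  then show ?thesis using internal assms(2) by simp
qed (use assms(2,3) in auto)

lemma idle_Inv:
  assumes "k < n" "l k = Inv t x"
  shows "control (c k) t = Idle" "control (c (Suc k)) t \<noteq> Idle"
  using step[OF assms(1)] assms(2) by (cases; auto)+

lemma finite_used: "k \<le> n \<Longrightarrow> finite (used (c k))"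
proof (induction k)
  case (Suc k)
  then have "k < n" by simp
  from step[OF this] Suc show ?case by cases auto
qed (simp add: init initial_def)

definition descr_words :: "'d set \<Rightarrow> 'w set" where
  "descr_words U = (\<Union>d \<in> U. set (words D d))"

lemma finite_descr_words: "finite U \<Longrightarrow> finite (descr_words U)"
  by (simp add: descr_words_def)

text \<open>Only invoked descriptors have pointers in memory, and finitely many steps invoke
  finitely many descriptors, each with a finite list of words.\<close>

lemma finite_pointers:
  assumes "k \<le> n"
  shows "finite {a. \<exists>w. mem k a = Ptr w}"
proof (rule finite_subset)
  have sh: "shared_inv k" using inv[OF assms] by (simp add: inv_def)
  show "{a. \<exists>w. mem k a = Ptr w} \<subseteq> address D ` descr_words (used (c k))"
  proof
    fix a
    assume "a \<in> {a. \<exists>w. mem k a = Ptr w}"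
    then obtain w where "mem k a = Ptr w" by blast
    then have "Ptr w \<in> seen k a" using mem_in_seen[of k a] by simp
    from seenD(1-3)[OF sh this] show "a \<in> address D ` descr_words (used (c k))"
      by (auto simp: descr_words_def)
  qed
  show "finite (address D ` descr_words (used (c k)))"
    using finite_used[OF assms] by (simp add: finite_descr_words)
qed

definition decided :: "'d set \<Rightarrow> nat \<Rightarrow> 'd set" where
  "decided U k = {d \<in> U. stat k d \<noteq> ACTIVE}"

definition installed :: "'d set \<Rightarrow> nat \<Rightarrow> 'w set" where
  "installed U k = {w \<in> descr_words U. Ptr w \<in> seen k (address D w)}"

text \<open>The parameter \<open>U\<close> is later the set of descriptors used once invocations
  have ceased; fixing it makes the count bounded.\<close>

definition progress :: "'d set \<Rightarrow> nat \<Rightarrow> nat" where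
  "progress U k = card (decided U k) + card (installed U k)"

lemma progress_bound:
  "finite U \<Longrightarrow> progress U k \<le> card U + card (descr_words U)"
  unfolding progress_def decided_def installed_def
  by (intro add_mono card_mono) (auto simp: finite_descr_words)

text \<open>A pointer is installed at most once and a status is decided at most once, so each
  modification of the shared memory is progress.\<close>

lemma progress_Suc:
  assumes "k < n" "finite U"
  shows "progress U k \<le> progress U (Suc k)"
    and "used (c k) \<subseteq> U \<Longrightarrow> mem (Suc k) \<noteq> mem k \<or> stat (Suc k) \<noteq> stat k \<Longrightarrow>
      progress U k < progress U (Suc k)"
proof -
  have inv_k: "inv k" using assms(1) inv by simp
  have fin: "finite (decided U (Suc k))" "finite (installed U (Suc k))"
    using assms(2) by (simp_all add: decided_def installed_def finite_descr_words)
  have sub: "decided U k \<subseteq> decided U (Suc k)" "installed U k \<subseteq> installed U (Suc k)"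
    using stat_Suc[OF assms(1)] by (auto simp: decided_def installed_def seen_Suc)
  note le = card_mono[OF fin(1) sub(1)] card_mono[OF fin(2) sub(2)]
  then show "progress U k \<le> progress U (Suc k)" unfolding progress_def by (rule add_mono)
  assume used: "used (c k) \<subseteq> U" and change: "mem (Suc k) \<noteq> mem k \<or> stat (Suc k) \<noteq> stat k"
  show "progress U k < progress U (Suc k)"
    using assms(1)
  proof (cases rule: shared_cases)
    case same
    then show ?thesis using change by simp
  next
    case (cas t d w ws mc)
    note new = M5_new[OF inv_k cas(1)]
    have "w \<in> installed U (Suc k)" "w \<notin> installed U k"
      using new(1,5,6) used by (auto simp: installed_def descr_words_def in_loop_def seen_Suc cas(2))
    then have "card (installed U k) < card (installed U (Suc k))"
      using sub(2) fin(2) by (intro psubset_card_mono) auto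
    then show ?thesis using le(1) by (simp add: progress_def)
  next
    case (status t d b mc)
    have "control_inv k t (M6 d b mc)" using inv_k status(1) by (metis inv_def)
    then have "d \<in> decided U (Suc k)" "d \<notin> decided U k"
      using used status by (auto simp: decided_def)
    then have "card (decided U k) < card (decided U (Suc k))"
      using sub(1) fin(1) by (intro psubset_card_mono) auto
    then show ?thesis using le(2) by (simp add: progress_def)
  qed
qed

end

lemma bounded_nat_eventually_constant:
  fixes f :: "nat \<Rightarrow> nat"
  assumes "\<And>k. k \<ge> i \<Longrightarrow> f k \<le> f (Suc k)" "\<And>k. k \<ge> i \<Longrightarrow> f k \<le> b"
  obtains N where "N \<ge> i" "\<forall>k \<ge> N. \<not> f k < f (Suc k)"
proof -
  obtain N where N: "N \<ge> i" "\<And>k. k \<ge> i \<Longrightarrow> f k \<le> f N"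
    using ex_has_greatest_nat[of "\<lambda>k. k \<ge> i" i f "Suc b"] assms(2) by (auto simp: less_Suc_eq_le)
  have "f N \<le> f k" if "k \<ge> N" for k
    using that
  proof (induction k rule: dec_induct)
    case (step m)
    then show ?case using assms(1)[of m] N(1) by simp
  qed simp
  then have "\<not> f k < f (Suc k)" if "k \<ge> N" for k
    using that N(1) N(2)[of "Suc k"] by (meson le_SucI le_trans not_less)
  then show ?thesis using that N(1) by blast
qed

section \<open>Infinite executions without responses\<close>

locale infinite_execution =
  fixes D :: "('a :: linorder, 'v, 'w, 'd) descriptors"
    and s0 :: "'a \<Rightarrow> 'v"
    and c :: "nat \<Rightarrow> ('t :: finite, 'a, 'v, 'w, 'd) config"
    and l :: "nat \<Rightarrow> ('t, ('a, 'v) mop, 'v result) label"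
  assumes wf_D: "wf_descriptors D"
    and start: "c 0 = initial s0"
    and steps: "mcas_step D (c k) (l k) (c (Suc k))"
begin

sublocale execution D s0 c l n for n
  by unfold_locales (use wf_D start steps in auto)

lemma ongoing_not_idle:
  assumes "ongoing l t i"
  shows "control (c i) t \<noteq> Idle"
proof -
  obtain k x where k: "k < i" "l k = Inv t x" "\<And>m r. k < m \<Longrightarrow> m < i \<Longrightarrow> l m \<noteq> Res t r"
    using assms unfolding ongoing_def by blast
  have "control (c j) t \<noteq> Idle" if "Suc k \<le> j" "j \<le> i" for j
    using that
  proof (induction j rule: dec_induct)
    case base
    show ?case by (rule idle_Inv(2)[OF lessI k(2)])
  next
    case (step m)
    then show ?case using non_idle_Suc[of m "Suc m" t] k(3)[of m] by auto
  qed
  then show ?thesis using k(1) by simp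
qed

text \<open>Without responses a busy thread stays busy and each invocation makes one more thread
  busy; there are only finitely many threads.\<close>

lemma no_response_no_invocation:
  assumes "\<And>k. k \<ge> i \<Longrightarrow> \<not> is_res (l k)"
  obtains N where "N \<ge> i" "\<forall>k \<ge> N. \<exists>t. l k = Tau t"
proof -
  define busy where "busy k = {t. control (c k) t \<noteq> Idle}" for k
  have sub: "busy k \<subseteq> busy (Suc k)" if "k \<ge> i" for k
    using non_idle_Suc[OF lessI] assms[OF that] by (auto simp: busy_def is_res_def)
  obtain N where N: "N \<ge> i" "\<forall>k \<ge> N. \<not> card (busy k) < card (busy (Suc k))"
  proof (rule bounded_nat_eventually_constant[of i "\<lambda>k. card (busy k)" "card (UNIV :: 't set)"])
    show "card (busy k) \<le> card (busy (Suc k))" if "k \<ge> i" for k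
      using sub[OF that] by (intro card_mono) simp_all
    show "card (busy k) \<le> card (UNIV :: 't set)" for k by (intro card_mono) simp_all
  qed
  have "\<exists>t. l k = Tau t" if "k \<ge> N" for k
  proof (cases "l k")
    case (Inv t x)
    then have "t \<in> busy (Suc k)" "t \<notin> busy k" using idle_Inv[OF lessI Inv] by (simp_all add: busy_def)
    then have "card (busy k) < card (busy (Suc k))"
      using sub[of k] that N(1) by (intro psubset_card_mono) auto
    then show ?thesis using N(2) that by simp
  qed (use assms that N(1) in \<open>auto simp: is_res_def\<close>)
  then show ?thesis using that N(1) by blast
qed

lemma eventually_quiescent:
  assumes "\<forall>k \<ge> i. \<exists>t. l k = Tau t"
  obtains N where "N \<ge> i" "\<forall>k \<ge> N. mem k = mem N \<and> stat k = stat N"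
proof -
  have used: "used (c k) = used (c i)" if "k \<ge> i" for k
    using that
  proof (induction k rule: dec_induct)
    case (step m)
    then show ?case using tau_cases(2)[OF lessI] assms by (metis dual_order.trans)
  qed simp
  have fin: "finite (used (c i))" using finite_used by blast
  obtain N where N: "N \<ge> i" "\<forall>k \<ge> N. \<not> progress (used (c i)) k < progress (used (c i)) (Suc k)"
    by (rule bounded_nat_eventually_constant[of i "progress (used (c i))",
          OF progress_Suc(1)[OF lessI fin] progress_bound[OF fin]])
  have same: "mem (Suc k) = mem k \<and> stat (Suc k) = stat k" if "k \<ge> N" for k
    using progress_Suc(2)[OF lessI fin, of k] used[of k] N that by auto
  have "mem k = mem N \<and> stat k = stat N" if "k \<ge> N" for k
    using that by (induction k rule: dec_induct) (use same in auto)
  then show ?thesis using that N(1) by blast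
qed

text \<open>The control of a thread changes only by its own steps, so it is unchanged when the
  thread is next scheduled.\<close>

lemma next_step:
  assumes "\<forall>k \<ge> N. \<exists>t. l k = Tau t" "\<And>m. \<exists>k \<ge> m. thread_of (l k) = t" "k \<ge> N"
  shows "\<exists>j \<ge> N. control (c j) t = control (c k) t \<and> l j = Tau t"
proof -
  define j where "j = (LEAST j. k \<le> j \<and> thread_of (l j) = t)"
  have j: "k \<le> j" "thread_of (l j) = t"
    unfolding j_def using LeastI_ex[OF assms(2)[of k]] by blast+
  have before: "thread_of (l m) \<noteq> t" if "k \<le> m" "m < j" for m
    using that not_less_Least[of m "\<lambda>j. k \<le> j \<and> thread_of (l j) = t"] by (auto simp: j_def)
  have "control (c m) t = control (c k) t" if "k \<le> m" "m \<le> j" for m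
    using that
  proof (induction m rule: dec_induct)
    case (step m)
    then show ?case using control_other[OF lessI, of t m] before[of m] by auto
  qed simp
  from this[OF j(1) order_refl] have "control (c j) t = control (c k) t" .
  moreover have "l j = Tau t" using assms(1)[rule_format, of j] assms(3) j by auto
  ultimately show ?thesis using j(1) assms(3) order_trans by blast
qed

lemma halting_thread:
  assumes "halts D (mem N, stat N) X"
    and "\<forall>k \<ge> N. mem k = mem N \<and> stat k = stat N"
    and "\<forall>k \<ge> N. \<exists>t. l k = Tau t"
    and "\<And>m. \<exists>k \<ge> m. thread_of (l k) = t"
    and "k \<ge> N"
  shows "control (c k) t \<noteq> X"
  using assms(1,5)
proof (induction arbitrary: k)
  case (halts_Done r)
  obtain j where j: "control (c j) t = control (c k) t" "l j = Tau t" "j \<ge> N"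
    using next_step[OF assms(3,4) halts_Done.prems] by blast
  then show ?case using tau_cases(4)[OF lessI j(2)] by auto
next
  case (halts_change X)
  obtain j where j: "control (c j) t = control (c k) t" "l j = Tau t" "j \<ge> N"
    using next_step[OF assms(3,4) halts_change.prems] by blast
  then show ?case
    using tau_cases(1)[OF lessI j(2)] assms(2)[rule_format, of j] assms(2)[rule_format, of "Suc j"]
      halts_change.hyps by auto
next
  case (halts_step X)
  obtain j where j: "control (c j) t = control (c k) t" "l j = Tau t" "j \<ge> N"
    using next_step[OF assms(3,4) halts_step.prems] by blast
  then show ?case
    using tau_cases(1)[OF lessI j(2)] assms(2)[rule_format, of j] halts_step.IH[of "Suc j"] by auto
qed

lemma response_exists:
  assumes "ongoing l t i" "\<And>m. \<exists>k \<ge> m. thread_of (l k) = t"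
  shows "\<exists>k \<ge> i. is_res (l k)"
proof (rule ccontr)
  assume "\<not> (\<exists>k \<ge> i. is_res (l k))"
  then have no_res: "\<not> is_res (l k)" if "k \<ge> i" for k using that by blast
  obtain M where M: "M \<ge> i" "\<forall>k \<ge> M. \<exists>t. l k = Tau t"
    by (rule no_response_no_invocation[OF no_res])
  obtain N where N: "N \<ge> M" "\<forall>k \<ge> N. mem k = mem N \<and> stat k = stat N"
    by (rule eventually_quiescent[OF M(2)])
  have "control (c N) t \<noteq> Idle"
    using order_trans[OF M(1) N(1)]
  proof (induction N rule: dec_induct)
    case base
    show ?case by (rule ongoing_not_idle[OF assms(1)])
  next
    case (step m)
    then show ?case using non_idle_Suc[OF lessI] no_res[of m] by (auto simp: is_res_def)
  qed
  then have "halts D (mem N, stat N) (control (c N) t)"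
    using inv[of N N] finite_pointers[of N N] control_halts[of N] by (auto simp: inv_def)
  moreover have "\<forall>k \<ge> N. \<exists>t. l k = Tau t" using M(2) N(1) by simp
  ultimately have "control (c N) t \<noteq> control (c N) t"
    using halting_thread[OF _ N(2) _ assms(2) order_refl] by blast
  then show False by simp
qed

end

theorem mainTheorem2:
  fixes D :: "('a :: linorder, 'v, 'w, 'd) descriptors"
    and s0 :: "'a \<Rightarrow> 'v"
    and c0 :: "('t :: finite, 'a, 'v, 'w, 'd) config"
  assumes "wf_descriptors D"
    and "c0 = initial s0"
  shows "linearizable mcas_spec s0 (mcas_step D) c0 \<and> lock_free (mcas_step D) c0"
proof
  show "linearizable mcas_spec s0 (mcas_step D) c0"
    unfolding linearizable_def
  proof (intro allI impI)
    fix ls cf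
    assume "run (mcas_step D) c0 ls cf"
    from run_execution[OF this] obtain c where c: "c 0 = c0" "\<forall>k < length ls. mcas_step D (c k) (ls ! k) (c (Suc k))"
      by blast
    interpret execution D s0 c "(!) ls" "length ls"
      using assms c by unfold_locales auto
    show "linearizable_history mcas_spec s0 (history ls)"
      by (rule linearizable_history[OF refl refl])
  qed
  show "lock_free (mcas_step D) c0"
    unfolding lock_free_def
  proof (intro allI impI)
    fix c :: "nat \<Rightarrow> ('t, 'a, 'v, 'w, 'd) config" and l i t
    assume c: "c 0 = c0 \<and> (\<forall>i. mcas_step D (c i) (l i) (c (Suc i)))"
      and t: "ongoing l t i \<and> (\<forall>m. \<exists>k \<ge> m. thread_of (l k) = t)"
    interpret infinite_execution D s0 c l
      using assms c by unfold_locales auto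
    show "\<exists>k \<ge> i. is_res (l k)"
      using t by (intro response_exists) auto
  qed
qed

end
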